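(* Let $0<l<L$, $a>0$, $\sigma>0$ be constants. Suppose $\varphi\in C^3([0,L])$, $\psi\in C^2([0,L])$ and $$\varphi(0)=\varphi(l)=\varphi(L)=0,\quad \varphi''(0)=\varphi''(l)=\varphi''(L)=0,\quad \psi(0)=\psi(l)=\psi(L)=0.$$ Then the coupled initial-boundary value problem $$u_{tt}-a^2u_{xx}=0\quad (0<x<l \text{ or } l<x<L,\ t>0),$$ $$u(0,t)=0,\qquad u(L,t)=0,$$ $$u(l-0,t)=u(l+0,t),\qquad -u_x(l-0,t)+u_x(l+0,t)=\sigma u(l,t),$$ $$u(x,0)=\varphi(x),\qquad u_t(x,0)=\psi(x)$$ has a formal analytical solution of the following form. For $0<x<l$, $$u(x,t)=\sum_{k=1}^\infty\Big(P_k\cos\frac{k\pi a}{l}t+Q_k\sin\frac{k\pi a}{l}t\Big)\sin\frac{k\pi}{l}x+\sum_{k=1}^\infty R_k(t)\sin\frac{k\pi}{l}x+\frac{x}{l}h(t),$$ and for $l<x<L$, $$u(x,t)=\sum_{k=1}^\infty\Big(\tilde P_k\cos\frac{k\pi a}{L-l}t+\tilde Q_k\sin\frac{k\pi a}{L-l}t\Big)\sin\frac{k\pi}{L-l}(x-l)+\sum_{k=1}^\infty \tilde R_k(t)\sin\frac{k\pi}{L-l}(x-l)+\frac{L-x}{L-l}h(t),$$ where $$P_k=\frac{2}{l}\int_0^l\Big(\varphi(\xi)-\frac{\xi}{l}h(0)\Big)\sin\frac{k\pi}{l}\xi\,d\xi,\qquad Q_k=\frac{2}{k\pi a}\int_0^l\Big(\psi(\xi)-\frac{\xi}{l}h'(0)\Big)\sin\frac{k\pi}{l}\xi\,d\xi,$$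 $$R_k(t)=\int_0^t\frac{2}{k\pi a}\int_0^l\Big(-\frac{\xi}{l}h''(\tau)\Big)\sin\frac{k\pi}{l}\xi\,d\xi\,\sin\frac{k\pi a}{l}(t-\tau)\,d\tau,$$ $$\tilde P_k=\frac{2}{L-l}\int_l^L\Big(\varphi(\eta)-\frac{L-\eta}{L-l}h(0)\Big)\sin\frac{k\pi}{L-l}(\eta-l)\,d\eta,$$ $$\tilde Q_k=\frac{2}{k\pi a}\int_l^L\Big(\psi(\eta)-\frac{L-\eta}{L-l}h'(0)\Big)\sin\frac{k\pi}{L-l}(\eta-l)\,d\eta,$$ $$\tilde R_k(t)=\int_0^t\frac{2}{k\pi a}\int_l^L\Big(-\frac{L-\eta}{L-l}h''(\tau)\Big)\sin\frac{k\pi}{L-l}(\eta-l)\,d\eta\,\sin\frac{k\pi a}{L-l}(t-\tau)\,d\tau,$$ and the function $h(t)$ (representing the common value $u(l-0,t)=u(l+0,t)$) satisfies $$-\sum_{k=1}^\infty\Big(P_k\cos\frac{k\pi a}{l}t+Q_k\sin\frac{k\pi a}{l}t\Big)(-1)^k\frac{k\pi}{l}-\sum_{k=1}^\infty R_k(t)(-1)^k\frac{k\pi}{l}-\frac1l h(t)$$ $$+\sum_{k=1}^\infty\Big(\tilde P_k\cos\frac{k\pi a}{L-l}t+\tilde Q_k\sin\frac{k\pi a}{L-l}t\Big)\frac{k\pi}{L-l}+\sum_{k=1}^\infty\tilde R_k(t)\frac{k\pi}{L-l}-\frac{1}{L-l}h(t)=\sigma h(t).$$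
   Context: Here $u_x(l\mp 0,t)$ and $u(l\mp 0,t)$ denote the one-sided limits at $x=l$ from the left and from the right; $h$ is a twice continuously differentiable function of $t\ge 0$. "Formal solution" means that the problem is satisfied by term-by-term manipulation of the series, without any assertion that the differentiated series converge. Precisely, with $V=u-\frac{x}{l}h(t)$ on $(0,l)$ and $V=u-\frac{L-x}{L-l}h(t)$ on $(l,L)$: (i) for each $k$, the $k$-th sine coefficient $V_k(t)$ of $V$ (with respect to $\sin\frac{k\pi}{l}x$ on $(0,l)$, respectively $\sin\frac{k\pi}{L-l}(x-l)$ on $(l,L)$) satisfies $V_k''+\omega_k^2V_k=g_k$, where $\omega_k=\frac{k\pi a}{l}$ (respectively $\frac{k\pi a}{L-l}$) and $g_k(t)$ is the $k$-th Fourier sine coefficient of $-\frac{x}{l}h''(t)$ (respectively $-\frac{L-x}{L-l}h''(t)$); (ii) $V_k(0)$ and $V_k'(0)$ are the $k$-th Fourier sine coefficients of $\varphi-\frac{x}{l}h(0)$ and $\psi-\frac{x}{l}h'(0)$ (respectively $\varphi-\frac{L-x}{L-l}h(0)$ and $\psi-\frac{L-x}{L-l}h'(0)$); (iii) the conditions at $x=0$, $x=L$ and the continuity condition at $x=l$ hold by substituting these values of $x$ term by term; (iv) the derivative jump condition at $x=l$ holds when $u_x(l\mp0,t)$ is computed by differentiating the series term by term. *)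

theory Defs
  imports "HOL-Analysis.Analysis"
begin

text \<open>Derivatives are taken within the set \<open>S\<close>, hence one-sided at the endpoints of a
  closed interval or half-line. They are unique whenever \<open>S\<close> has no isolated points, as is
  the case for the sets used here.\<close>

definition deriv_on :: "real set \<Rightarrow> nat \<Rightarrow> (real \<Rightarrow> real) \<Rightarrow> real \<Rightarrow> real" where
  "deriv_on S n f = ((\<lambda>g x. vector_derivative g (at x within S)) ^^ n) f"

definition C_on :: "nat \<Rightarrow> real set \<Rightarrow> (real \<Rightarrow> real) \<Rightarrow> bool" where
  "C_on n S f \<longleftrightarrow>
     (\<forall>j<n. deriv_on S j f differentiable_on S) \<and> continuous_on S (deriv_on S n f)"

text \<open>Convergence of \<open>f 1 + f 2 + f 3 + \<dots>\<close>; all series here start at index 1.\<close>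

definition sums_from_1 :: "(nat \<Rightarrow> real) \<Rightarrow> real \<Rightarrow> bool" (infixr "sums\<^sub>1" 80) where
  "f sums\<^sub>1 s \<longleftrightarrow> (\<lambda>n. f (Suc n)) sums s"

definition sine_mode :: "real \<Rightarrow> real \<Rightarrow> nat \<Rightarrow> real \<Rightarrow> real" where
  "sine_mode p q k x = sin (real k * pi / (q - p) * (x - p))"

definition sine_coeff :: "real \<Rightarrow> real \<Rightarrow> nat \<Rightarrow> (real \<Rightarrow> real) \<Rightarrow> real" where
  "sine_coeff p q k f = 2 / (q - p) * integral {p..q} (\<lambda>x. f x * sine_mode p q k x)"

text \<open>On an interval \<open>(p, q)\<close> the unknown is split as \<open>u x t = V x t + e x * h t\<close> with an affine
  function \<open>e\<close>; \<open>V_coeff\<close> is the \<open>k\<close>-th sine coefficient of \<open>V\<close> at time \<open>t\<close>.\<close>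

definition V_coeff :: "real \<Rightarrow> real \<Rightarrow> (real \<Rightarrow> real) \<Rightarrow> (real \<Rightarrow> real) \<Rightarrow> (real \<Rightarrow> real \<Rightarrow> real) \<Rightarrow>
    nat \<Rightarrow> real \<Rightarrow> real" where
  "V_coeff p q e h u k t = sine_coeff p q k (\<lambda>x. u x t - e x * h t)"

text \<open>\<open>series_value \<dots> t x s\<close>: substituting \<open>x\<close> term by term into
  \<open>\<Sum>k. V\<^sub>k t * sine_mode p q k x + e x * h t\<close> gives \<open>s\<close>.
  \<open>series_slope \<dots> t x s\<close>: differentiating this series in \<open>x\<close> term by term and evaluating at \<open>x\<close>
  gives \<open>s\<close>.\<close>

definition series_value :: "real \<Rightarrow> real \<Rightarrow> (real \<Rightarrow> real) \<Rightarrow> (real \<Rightarrow> real) \<Rightarrow> (real \<Rightarrow> real \<Rightarrow> real) \<Rightarrow>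
    real \<Rightarrow> real \<Rightarrow> real \<Rightarrow> bool" where
  "series_value p q e h u t x s \<longleftrightarrow>
     (\<lambda>k. V_coeff p q e h u k t * sine_mode p q k x) sums\<^sub>1 (s - e x * h t)"

definition series_slope :: "real \<Rightarrow> real \<Rightarrow> (real \<Rightarrow> real) \<Rightarrow> (real \<Rightarrow> real) \<Rightarrow> (real \<Rightarrow> real \<Rightarrow> real) \<Rightarrow>
    real \<Rightarrow> real \<Rightarrow> real \<Rightarrow> bool" where
  "series_slope p q e h u t x s \<longleftrightarrow>
     (\<lambda>k. V_coeff p q e h u k t * deriv (sine_mode p q k) x) sums\<^sub>1 (s - deriv e x * h t)"

text \<open>The wave equation and the initial conditions on \<open>(p, q)\<close>, expressed mode by mode. Since \<open>e\<close> is
  affine, the equation for \<open>u\<close> becomes \<open>V\<^sub>t\<^sub>t - a\<^sup>2 V\<^sub>x\<^sub>x = - e x * h'' t\<close>.\<close>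

definition formal_wave_ivp :: "real \<Rightarrow> real \<Rightarrow> real \<Rightarrow> (real \<Rightarrow> real) \<Rightarrow> (real \<Rightarrow> real) \<Rightarrow> (real \<Rightarrow> real) \<Rightarrow>
    (real \<Rightarrow> real) \<Rightarrow> (real \<Rightarrow> real \<Rightarrow> real) \<Rightarrow> bool" where
  "formal_wave_ivp a p q e \<phi> \<psi> h u \<longleftrightarrow>
     (\<forall>k\<ge>1.
        C_on 2 {0..} (V_coeff p q e h u k) \<and>
        (\<forall>t\<ge>0. deriv_on {0..} 2 (V_coeff p q e h u k) t
                 + (real k * pi * a / (q - p))\<^sup>2 * V_coeff p q e h u k t
               = sine_coeff p q k (\<lambda>x. - e x * deriv_on {0..} 2 h t)) \<and>
        V_coeff p q e h u k 0 = sine_coeff p q k (\<lambda>x. \<phi> x - e x * h 0) \<and>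
        deriv_on {0..} 1 (V_coeff p q e h u k) 0
          = sine_coeff p q k (\<lambda>x. \<psi> x - e x * deriv_on {0..} 1 h 0))"

text \<open>Formal solution of the coupled problem. The derivatives of \<open>u\<close> itself never occur; the only
  differentiated series is that of the jump condition, which is evaluated at \<open>x = l\<close> only.\<close>

definition formal_solution :: "real \<Rightarrow> real \<Rightarrow> real \<Rightarrow> real \<Rightarrow> (real \<Rightarrow> real) \<Rightarrow> (real \<Rightarrow> real) \<Rightarrow>
    (real \<Rightarrow> real) \<Rightarrow> (real \<Rightarrow> real \<Rightarrow> real) \<Rightarrow> bool" where
  "formal_solution l L a \<sigma> \<phi> \<psi> h u \<longleftrightarrow>
     (let e1 = (\<lambda>x. x / l); e2 = (\<lambda>x. (L - x) / (L - l)) in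
        (\<forall>t\<ge>0. (\<forall>x\<in>{0<..<l}. series_value 0 l e1 h u t x (u x t)) \<and>
                (\<forall>x\<in>{l<..<L}. series_value l L e2 h u t x (u x t))) \<and>
        formal_wave_ivp a 0 l e1 \<phi> \<psi> h u \<and>
        formal_wave_ivp a l L e2 \<phi> \<psi> h u \<and>
        (\<forall>t\<ge>0. series_value 0 l e1 h u t 0 (u 0 t) \<and> u 0 t = 0) \<and>
        (\<forall>t\<ge>0. series_value l L e2 h u t L (u L t) \<and> u L t = 0) \<and>
        (\<forall>t\<ge>0. series_value 0 l e1 h u t l (u l t) \<and> series_value l L e2 h u t l (u l t)) \<and>
        (\<forall>t\<ge>0. \<exists>m r. series_slope 0 l e1 h u t l m \<and> series_slope l L e2 h u t l r \<and>
                      - m + r = \<sigma> * u l t))"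

definition P_coeff :: "real \<Rightarrow> (real \<Rightarrow> real) \<Rightarrow> (real \<Rightarrow> real) \<Rightarrow> nat \<Rightarrow> real" where
  "P_coeff l \<phi> h k =
     2 / l * integral {0..l} (\<lambda>\<xi>. (\<phi> \<xi> - \<xi> / l * h 0) * sin (real k * pi / l * \<xi>))"

definition Q_coeff :: "real \<Rightarrow> real \<Rightarrow> (real \<Rightarrow> real) \<Rightarrow> (real \<Rightarrow> real) \<Rightarrow> nat \<Rightarrow> real" where
  "Q_coeff l a \<psi> h k =
     2 / (real k * pi * a) *
     integral {0..l} (\<lambda>\<xi>. (\<psi> \<xi> - \<xi> / l * deriv_on {0..} 1 h 0) * sin (real k * pi / l * \<xi>))"

definition R_coeff :: "real \<Rightarrow> real \<Rightarrow> (real \<Rightarrow> real) \<Rightarrow> nat \<Rightarrow> real \<Rightarrow> real" where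
  "R_coeff l a h k t =
     integral {0..t} (\<lambda>\<tau>. 2 / (real k * pi * a) *
       integral {0..l} (\<lambda>\<xi>. (- \<xi> / l * deriv_on {0..} 2 h \<tau>) * sin (real k * pi / l * \<xi>)) *
       sin (real k * pi * a / l * (t - \<tau>)))"

definition Pt_coeff :: "real \<Rightarrow> real \<Rightarrow> (real \<Rightarrow> real) \<Rightarrow> (real \<Rightarrow> real) \<Rightarrow> nat \<Rightarrow> real" where
  "Pt_coeff l L \<phi> h k =
     2 / (L - l) *
     integral {l..L} (\<lambda>\<eta>. (\<phi> \<eta> - (L - \<eta>) / (L - l) * h 0) * sin (real k * pi / (L - l) * (\<eta> - l)))"

definition Qt_coeff :: "real \<Rightarrow> real \<Rightarrow> real \<Rightarrow> (real \<Rightarrow> real) \<Rightarrow> (real \<Rightarrow> real) \<Rightarrow> nat \<Rightarrow> real" where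
  "Qt_coeff l L a \<psi> h k =
     2 / (real k * pi * a) *
     integral {l..L} (\<lambda>\<eta>. (\<psi> \<eta> - (L - \<eta>) / (L - l) * deriv_on {0..} 1 h 0) *
                          sin (real k * pi / (L - l) * (\<eta> - l)))"

definition Rt_coeff :: "real \<Rightarrow> real \<Rightarrow> real \<Rightarrow> (real \<Rightarrow> real) \<Rightarrow> nat \<Rightarrow> real \<Rightarrow> real" where
  "Rt_coeff l L a h k t =
     integral {0..t} (\<lambda>\<tau>. 2 / (real k * pi * a) *
       integral {l..L} (\<lambda>\<eta>. (- (L - \<eta>) / (L - l) * deriv_on {0..} 2 h \<tau>) *
                            sin (real k * pi / (L - l) * (\<eta> - l))) *
       sin (real k * pi * a / (L - l) * (t - \<tau>)))"

end

theory Submission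
  imports Defs
begin

text \<open>The formal solution is obtained from a classical one. On the left segment write
  \<open>u = F (a t + x) - F (a t - x)\<close>, on the right segment \<open>u = G (a t + (L - x)) - G (a t - (L - x))\<close>; these satisfy
  the wave equation and vanish at \<open>x = 0\<close> and \<open>x = L\<close>. The initial data determine \<open>F\<close> on \<open>[-l, l]\<close> and \<open>G\<close> on
  \<open>[-(L - l), L - l]\<close>. The common boundary value \<open>h\<close> at \<open>x = l\<close> has to satisfy
  \<open>h t = F (a t + l) - F (a t - l) = G (a t + (L - l)) - G (a t - (L - l))\<close>, and the jump condition becomes
  \<open>h' + (a \<sigma> / 2) h = - a (F' (a t - l) + G' (a t - (L - l)))\<close>. The right-hand side contains only waves arriving at the
  interface, that is, the past of \<open>F\<close> and \<open>G\<close>; so this is a retarded equation, solved step by step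
  (\<open>delay_system_solvable\<close>, \<open>transmission_profiles_exist\<close>). The compatibility conditions at \<open>x = 0\<close> and \<open>x = L\<close> make
  \<open>F''\<close> and \<open>G''\<close> continuous at \<open>0\<close>, and those at \<open>x = l\<close> say that \<open>h\<close> starts with \<open>h = h' = h'' = 0\<close>; thus \<open>F\<close>, \<open>G\<close> and
  \<open>h\<close> are twice continuously differentiable.

  For such a \<open>C\<^sup>2\<close> solution, \<open>V = u - e h\<close> vanishes at both ends of each segment. Differentiating
  its sine coefficients under the integral sign and integrating by parts twice yields the oscillator equations
  (\<open>W_oscillator\<close>), and variation of constants yields the formulas with \<open>P\<^sub>k\<close>, \<open>Q\<^sub>k\<close>, \<open>R\<^sub>k\<close> (\<open>V_coeff_split\<close>).

  The series have to converge to the right values even after one differentiation in \<open>x\<close>, at the end points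
  included. Since \<open>V\<^sub>x\<^sub>x\<close> is continuous, Bessel's inequality makes \<open>\<Sum> k |V\<^sub>k|\<close> finite (\<open>sine_coeff_summable\<close>), and
  completeness of the cosine system, a consequence of Weierstrass approximation, identifies the sum of the
  differentiated series with \<open>V\<^sub>x\<close> (\<open>sine_series_expansion\<close>). The relation required of \<open>h\<close> is then the jump
  condition of the classical solution.\<close>

section \<open>Derivatives within a set\<close>

lemma deriv_on_0 [simp]: "deriv_on S 0 f = f"
  by (simp add: deriv_on_def)

lemma deriv_on_Suc: "deriv_on S (Suc n) f x = vector_derivative (deriv_on S n f) (at x within S)"
  by (simp add: deriv_on_def)

lemma C_on_has_derivative:
  assumes "C_on n S f" and "j < n" and "x \<in> S"
  shows "(deriv_on S j f has_real_derivative deriv_on S (Suc j) f x) (at x within S)"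
  using assms unfolding C_on_def differentiable_on_def deriv_on_Suc
    has_real_derivative_iff_has_vector_derivative
  by (auto simp: vector_derivative_works[symmetric])

lemma C_on_continuous:
  assumes "C_on n S f" and "j \<le> n"
  shows "continuous_on S (deriv_on S j f)"
  using assms unfolding C_on_def
  by (cases "j = n") (auto intro: differentiable_imp_continuous_on)

lemma half_line_not_bot: "0 \<le> (x::real) \<Longrightarrow> at x within {0..} \<noteq> bot"
  using islimpt_subset[of x "{x..x + 1}" "{0..}"] islimpt_Icc[of x "x + 1" x]
  by (auto simp: trivial_limit_within)

text \<open>Evaluates \<open>deriv_on\<close> on the half-line for a function known only there: \<open>f\<close> may be arbitrary at
  negative times, as are the coefficients \<open>V_coeff\<close>, because derivatives within \<open>{0..}\<close> do not see
  these values.\<close>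
lemma deriv_on_half_line:
  fixes f g :: "real \<Rightarrow> real"
  assumes eq: "\<forall>t\<ge>0. f t = g t"
    and g1: "\<And>t. 0 \<le> t \<Longrightarrow> (g has_real_derivative g1 t) (at t within {0..})"
    and g2: "\<And>t. 0 \<le> t \<Longrightarrow> (g1 has_real_derivative g2 t) (at t within {0..})"
    and cont: "continuous_on {0..} g2"
  shows "C_on 2 {0..} f"
    and "\<And>t. 0 \<le> t \<Longrightarrow> deriv_on {0..} 1 f t = g1 t"
    and "\<And>t. 0 \<le> t \<Longrightarrow> deriv_on {0..} 2 f t = g2 t"
proof -
  have f1: "(f has_vector_derivative g1 t) (at t within {0..})" if "0 \<le> t" for t
    using has_vector_derivative_transform[of t "{0..}" f g "g1 t"] eq g1[OF that] that
    by (auto simp: has_real_derivative_iff_has_vector_derivative)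
  have d1: "deriv_on {0..} 1 f t = g1 t" if "0 \<le> t" for t
    using vector_derivative_within[OF half_line_not_bot[OF that] f1[OF that]]
    by (simp add: deriv_on_Suc)
  have f2: "(deriv_on {0..} 1 f has_vector_derivative g2 t) (at t within {0..})" if "0 \<le> t" for t
    using has_vector_derivative_transform[of t "{0..}" "deriv_on {0..} 1 f" g1 "g2 t"] d1 g2[OF that] that
    by (auto simp: has_real_derivative_iff_has_vector_derivative)
  have d2: "deriv_on {0..} 2 f t = g2 t" if "0 \<le> t" for t
    using vector_derivative_within[OF half_line_not_bot[OF that] f2[OF that]]
    by (simp add: deriv_on_Suc numeral_2_eq_2)
  have "deriv_on {0..} j f differentiable_on {0..}" if "j < 2" for j
  proof -
    have "j = 0 \<or> j = 1" using that by auto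
    then show ?thesis
      using differentiableI_vector[OF f1] differentiableI_vector[OF f2]
      by (auto simp: differentiable_on_def)
  qed
  moreover have "continuous_on {0..} (deriv_on {0..} 2 f)"
    using cont continuous_on_cong[of "{0..}" "{0..}" "deriv_on {0..} 2 f" g2] d2 by simp
  ultimately show "C_on 2 {0..} f" by (simp add: C_on_def)
  show "\<And>t. 0 \<le> t \<Longrightarrow> deriv_on {0..} 1 f t = g1 t" by (rule d1)
  show "\<And>t. 0 \<le> t \<Longrightarrow> deriv_on {0..} 2 f t = g2 t" by (rule d2)
qed

section \<open>Sine series of functions vanishing at the end points\<close>

definition wave_number :: "real \<Rightarrow> real \<Rightarrow> nat \<Rightarrow> real" where
  "wave_number p q k = real k * pi / (q - p)"

definition cosine_mode :: "real \<Rightarrow> real \<Rightarrow> nat \<Rightarrow> real \<Rightarrow> real" where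
  "cosine_mode p q k x = cos (wave_number p q k * (x - p))"

lemma sine_mode_wave_number: "sine_mode p q k x = sin (wave_number p q k * (x - p))"
  by (simp add: sine_mode_def wave_number_def)

lemma sine_mode_has_derivative [derivative_intros]:
  "(sine_mode p q k has_real_derivative wave_number p q k * cosine_mode p q k x) (at x within S)"
  unfolding sine_mode_wave_number[abs_def] cosine_mode_def
  by (auto intro!: derivative_eq_intros)

lemma cosine_mode_has_derivative [derivative_intros]:
  "(cosine_mode p q k has_real_derivative - wave_number p q k * sine_mode p q k x) (at x within S)"
  unfolding sine_mode_wave_number cosine_mode_def[abs_def]
  by (auto intro!: derivative_eq_intros)

lemma continuous_on_modes [continuous_intros]:
  "continuous_on S (sine_mode p q k)" "continuous_on S (cosine_mode p q k)"
  unfolding sine_mode_wave_number[abs_def] cosine_mode_def[abs_def]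
  by (auto intro!: continuous_intros)

lemma deriv_sine_mode: "deriv (sine_mode p q k) x = wave_number p q k * cosine_mode p q k x"
  by (rule DERIV_imp_deriv) (rule sine_mode_has_derivative)

lemma wave_number_nonneg: "p < q \<Longrightarrow> 0 \<le> wave_number p q k"
  by (simp add: wave_number_def)

lemma wave_number_pos: "p < q \<Longrightarrow> 1 \<le> k \<Longrightarrow> 0 < wave_number p q k"
  by (simp add: wave_number_def)

lemma wave_number_length: "p < q \<Longrightarrow> wave_number p q k * (q - p) = real k * pi"
  by (simp add: wave_number_def)

lemma sine_mode_ends: "p < q \<Longrightarrow> sine_mode p q k p = 0" "p < q \<Longrightarrow> sine_mode p q k q = 0"
  by (simp_all add: sine_mode_wave_number wave_number_length)

lemma cosine_mode_ends: "p < q \<Longrightarrow> cosine_mode p q k p = 1" "p < q \<Longrightarrow> cosine_mode p q k q = (-1) ^ k"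
  by (simp_all add: cosine_mode_def wave_number_length cos_npi)

lemma abs_modes_le_1: "\<bar>sine_mode p q k x\<bar> \<le> 1" "\<bar>cosine_mode p q k x\<bar> \<le> 1"
  by (simp_all add: sine_mode_wave_number cosine_mode_def)

lemma integral_cosine_full_periods:
  assumes "p < q" and "n \<noteq> 0"
  shows "((\<lambda>x. cos (of_int n * pi / (q - p) * (x - p))) has_integral 0) {p..q}"
proof -
  let ?w = "of_int n * pi / (q - p)"
  have w: "?w \<noteq> 0" using assms by simp
  have "((\<lambda>x. cos (?w * (x - p))) has_integral
      sin (?w * (q - p)) / ?w - sin (?w * (p - p)) / ?w) {p..q}"
  proof (rule fundamental_theorem_of_calculus)
    fix x
    have "((\<lambda>x. sin (w * (x - p)) / w) has_real_derivative cos (w * (x - p))) (at x within {p..q})"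
      if "w \<noteq> 0" for w
      using that by (auto intro!: derivative_eq_intros)
    from this[OF w]
    show "((\<lambda>x. sin (?w * (x - p)) / ?w) has_vector_derivative cos (?w * (x - p))) (at x within {p..q})"
      by (simp add: has_real_derivative_iff_has_vector_derivative)
  qed (use assms in simp)
  moreover have "sin (?w * (q - p)) = 0"
    using assms sin_zero_iff_int2[of "?w * (q - p)"] by auto
  ultimately show ?thesis by simp
qed

lemma mode_products:
  "cosine_mode p q j x * cosine_mode p q k x =
     (cos (of_int (int j - int k) * pi / (q - p) * (x - p)) + cos (of_int (int j + int k) * pi / (q - p) * (x - p))) / 2"
  "sine_mode p q j x * sine_mode p q k x =
     (cos (of_int (int j - int k) * pi / (q - p) * (x - p)) - cos (of_int (int j + int k) * pi / (q - p) * (x - p))) / 2"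
  by (simp_all add: cosine_mode_def sine_mode_wave_number wave_number_def cos_times_cos sin_times_sin
      left_diff_distrib distrib_right add_divide_distrib diff_divide_distrib)

lemma mode_orthogonality:
  assumes "p < q" and "1 \<le> k"
  shows "((\<lambda>x. cosine_mode p q j x * cosine_mode p q k x) has_integral (if j = k then (q - p) / 2 else 0)) {p..q}"
    and "((\<lambda>x. sine_mode p q j x * sine_mode p q k x) has_integral (if j = k then (q - p) / 2 else 0)) {p..q}"
proof -
  have s: "((\<lambda>x. cos (of_int (int j + int k) * pi / (q - p) * (x - p))) has_integral 0) {p..q}"
    using integral_cosine_full_periods[OF assms(1), of "int j + int k"] assms(2) by auto
  have d: "((\<lambda>x. cos (of_int (int j - int k) * pi / (q - p) * (x - p))) has_integral (if j = k then q - p else 0)) {p..q}"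
    using integral_cosine_full_periods[OF assms(1), of "int j - int k"] assms
      has_integral_const_real[of "1::real" p q] by auto
  show "((\<lambda>x. cosine_mode p q j x * cosine_mode p q k x) has_integral (if j = k then (q - p) / 2 else 0)) {p..q}"
    using has_integral_divide[OF has_integral_add[OF d s], of 2] unfolding mode_products
    by (auto split: if_splits)
  show "((\<lambda>x. sine_mode p q j x * sine_mode p q k x) has_integral (if j = k then (q - p) / 2 else 0)) {p..q}"
    using has_integral_divide[OF has_integral_diff[OF d s], of 2] unfolding mode_products
    by (auto split: if_splits)
qed

text \<open>Multiplication by the first cosine shifts the frequency by one in both directions. Hence a function
  orthogonal to all cosines is orthogonal to all cosines times powers of the first one.\<close>
lemma cosine_mode_times_first:
  "cosine_mode p q (Suc k) x * cosine_mode p q 1 x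
     = (cosine_mode p q k x + cosine_mode p q (Suc (Suc k)) x) / 2"
proof -
  have "wave_number p q (Suc j) = wave_number p q j + wave_number p q 1" for j
    by (simp add: wave_number_def distrib_right add_divide_distrib)
  then have "wave_number p q (Suc j) * (x - p) = wave_number p q j * (x - p) + wave_number p q 1 * (x - p)" for j
    by (metis distrib_right)
  from this[of k] this[of "Suc k"] show ?thesis
    unfolding cosine_mode_def cos_times_cos by simp
qed

text \<open>With \<open>\<theta> x = cos (pi (x - p) / (q - p))\<close>, a function orthogonal to all cosine modes is orthogonal to every
  polynomial in \<open>\<theta>\<close>. As \<open>\<theta>\<close> maps \<open>[p, q]\<close> bijectively onto \<open>[-1, 1]\<close>, Weierstrass approximation of
  \<open>g \<circ> \<theta>\<^sup>-\<^sup>1\<close> makes \<open>g\<close> a uniform limit of such polynomials, so \<open>g\<close> is orthogonal to itself.\<close>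
lemma cosine_system_complete:
  assumes pq: "p < q" and cont: "continuous_on {p..q} g"
    and orth: "\<And>k. integral {p..q} (\<lambda>x. g x * cosine_mode p q k x) = 0"
    and x: "x \<in> {p..q}"
  shows "g x = 0"
proof -
  define \<theta> where "\<theta> = cosine_mode p q 1"
  have \<theta>_cont [continuous_intros]: "continuous_on S \<theta>" for S
    unfolding \<theta>_def by (rule continuous_on_modes)
  note [continuous_intros] = cont
  note int = integrable_continuous_interval
  have mom: "((\<lambda>x. g x * cosine_mode p q k x * \<theta> x ^ n) has_integral 0) {p..q}" for k n
  proof (induction n arbitrary: k)
    case 0
    have "(\<lambda>x. g x * cosine_mode p q k x) integrable_on {p..q}"
      by (intro int continuous_intros)
    then show ?case using orth by (simp add: has_integral_iff)
  next
    case (Suc n)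
    show ?case
    proof (cases k)
      case 0
      have eq: "g x * cosine_mode p q k x * \<theta> x ^ Suc n = g x * cosine_mode p q 1 x * \<theta> x ^ n" for x
        by (simp add: 0 \<theta>_def cosine_mode_def wave_number_def)
      show ?thesis unfolding eq by (rule Suc.IH)
    next
      case (Suc j)
      have eq: "g x * cosine_mode p q k x * \<theta> x ^ Suc n
          = (g x * cosine_mode p q j x * \<theta> x ^ n + g x * cosine_mode p q (Suc (Suc j)) x * \<theta> x ^ n) / 2" for x
      proof -
        have "g x * cosine_mode p q k x * \<theta> x ^ Suc n = g x * (cosine_mode p q k x * \<theta> x) * \<theta> x ^ n"
          by simp
        also have "cosine_mode p q k x * \<theta> x = (cosine_mode p q j x + cosine_mode p q (Suc (Suc j)) x) / 2"
          unfolding \<theta>_def Suc by (rule cosine_mode_times_first)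
        also have "g x * \<dots> * \<theta> x ^ n
          = (g x * cosine_mode p q j x * \<theta> x ^ n + g x * cosine_mode p q (Suc (Suc j)) x * \<theta> x ^ n) / 2"
          by (simp only: distrib_left distrib_right times_divide_eq_right times_divide_eq_left)
        finally show ?thesis .
      qed
      show ?thesis
        unfolding eq
        using has_integral_divide[OF has_integral_add[OF Suc.IH[of j] Suc.IH[of "Suc (Suc j)"]], of 2] by simp
    qed
  qed
  have poly: "((\<lambda>x. g x * P (\<theta> x)) has_integral 0) {p..q}" if P: "real_polynomial_function P" for P
  proof -
    obtain a n where P_sum: "P = (\<lambda>x. \<Sum>i\<le>n. a i * x ^ i)"
      using P real_polynomial_function_iff_sum by auto
    have "((\<lambda>x. \<Sum>i\<le>n. a i * (g x * cosine_mode p q 0 x * \<theta> x ^ i)) has_integral (\<Sum>i\<le>n. a i * 0)) {p..q}"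
      by (intro has_integral_sum has_integral_mult_right mom) simp
    moreover have "(\<Sum>i\<le>n. a i * (g x * cosine_mode p q 0 x * \<theta> x ^ i)) = g x * P (\<theta> x)" for x
      unfolding P_sum sum_distrib_left by (rule sum.cong) (simp_all add: cosine_mode_def wave_number_def)
    ultimately show ?thesis by simp
  qed
  let ?J = "integral {p..q} (\<lambda>x. \<bar>g x\<bar>)"
  have J: "0 \<le> ?J"
    by (intro integral_nonneg int continuous_intros) simp
  \<comment> \<open>the function \<open>g\<close> in the variable \<open>y = \<theta> x\<close>\<close>
  define \<gamma> where "\<gamma> y = g (p + (q - p) / pi * arccos y)" for y
  have arg: "p + (q - p) / pi * arccos y \<in> {p..q}" if "y \<in> {-1..1}" for y
  proof -
    have "0 \<le> arccos y" "arccos y \<le> pi" using that by (auto intro: arccos_lbound arccos_ubound)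
    then have "(q - p) / pi * arccos y \<le> (q - p) / pi * pi"
      using pq by (intro mult_left_mono) auto
    moreover have "0 \<le> (q - p) / pi * arccos y" using \<open>0 \<le> arccos y\<close> pq by simp
    ultimately show ?thesis by simp
  qed
  have "continuous_on {-1..1} \<gamma>" unfolding \<gamma>_def
    by (rule continuous_on_compose2[OF cont]) (use arg in \<open>auto intro!: continuous_intros\<close>)
  have \<gamma>: "\<gamma> (\<theta> y) = g y" if "y \<in> {p..q}" for y
  proof -
    have "wave_number p q 1 * (y - p) \<le> wave_number p q 1 * (q - p)"
      using that wave_number_nonneg[OF pq] by (intro mult_left_mono) auto
    then have "wave_number p q 1 * (y - p) \<le> pi"
      using wave_number_length[OF pq, of 1] by simp
    moreover have "0 \<le> wave_number p q 1 * (y - p)"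
      using that wave_number_nonneg[OF pq] by simp
    ultimately have "arccos (\<theta> y) = wave_number p q 1 * (y - p)"
      unfolding \<theta>_def cosine_mode_def by (intro arccos_cos)
    then show ?thesis using pq by (simp add: \<gamma>_def wave_number_def)
  qed
  have le: "integral {p..q} (\<lambda>x. g x * g x) \<le> e * ?J" if e: "0 < e" for e
  proof -
    obtain P where P: "real_polynomial_function P" "\<And>y. y \<in> {-1..1} \<Longrightarrow> \<bar>\<gamma> y - P y\<bar> < e"
      using Stone_Weierstrass_real_polynomial_function[OF compact_Icc \<open>continuous_on {-1..1} \<gamma>\<close> e] by blast
    obtain a n where P_sum: "P = (\<lambda>x. \<Sum>i\<le>n. a i * x ^ i)"
      using P(1) real_polynomial_function_iff_sum by auto
    have cP: "continuous_on {p..q} (\<lambda>x. P (\<theta> x))"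
      unfolding P_sum by (intro continuous_intros)
    note [continuous_intros] = cP
    have "integral {p..q} (\<lambda>x. g x * g x) = integral {p..q} (\<lambda>x. g x * g x) - integral {p..q} (\<lambda>x. g x * P (\<theta> x))"
      using poly[OF P(1)] by (simp add: integral_unique)
    also have "\<dots> = integral {p..q} (\<lambda>x. g x * g x - g x * P (\<theta> x))"
      by (rule integral_diff[symmetric]) (intro int continuous_intros)+
    also have "\<dots> \<le> integral {p..q} (\<lambda>x. e * \<bar>g x\<bar>)"
    proof (rule integral_le)
      fix y assume y: "y \<in> {p..q}"
      have "\<theta> y \<in> {-1..1}" using abs_modes_le_1(2)[of p q 1 y] unfolding \<theta>_def by auto
      then have "\<bar>g y - P (\<theta> y)\<bar> \<le> e" using P(2) \<gamma>[OF y] by force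
      then have "\<bar>g y\<bar> * \<bar>g y - P (\<theta> y)\<bar> \<le> \<bar>g y\<bar> * e" by (rule mult_left_mono) simp
      moreover have "g y * (g y - P (\<theta> y)) \<le> \<bar>g y\<bar> * \<bar>g y - P (\<theta> y)\<bar>"
        by (metis abs_ge_self abs_mult)
      ultimately show "g y * g y - g y * P (\<theta> y) \<le> e * \<bar>g y\<bar>" by (simp add: algebra_simps)
    qed (intro int continuous_intros)+
    finally show ?thesis by simp
  qed
  have "integral {p..q} (\<lambda>x. g x * g x) \<le> 0"
  proof (rule ccontr)
    assume "\<not> ?thesis"
    then have I: "0 < integral {p..q} (\<lambda>x. g x * g x)" by simp
    let ?I = "integral {p..q} (\<lambda>x. g x * g x)"
    have "?I \<le> ?I / (?J + 1) * ?J" using le[of "?I / (?J + 1)"] I J by simp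
    also have "\<dots> = ?I * (?J / (?J + 1))" by simp
    also have "\<dots> < ?I * 1" using I J by (intro mult_strict_left_mono) auto
    finally show False by simp
  qed
  moreover have "0 \<le> integral {p..q} (\<lambda>x. g x * g x)"
    by (intro integral_nonneg int continuous_intros) simp
  ultimately have "integral {p..q} (\<lambda>x. g x * g x) = 0" by simp
  then have "g x * g x = 0"
    using integral_eq_0_iff[of p q "\<lambda>x. g x * g x"] x pq
      continuous_on_mult[OF cont cont] by simp
  then show ?thesis by simp
qed

lemma sine_coeff_has_integral:
  assumes "p < q" and "continuous_on {p..q} f"
  shows "((\<lambda>x. f x * sine_mode p q k x) has_integral ((q - p) / 2 * sine_coeff p q k f)) {p..q}"
proof -
  have "(\<lambda>x. f x * sine_mode p q k x) integrable_on {p..q}"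
    by (intro integrable_continuous_interval continuous_intros assms)
  then show ?thesis using assms(1) by (simp add: has_integral_iff sine_coeff_def)
qed

lemma sine_coeff_unique:
  assumes "p < q" and "((\<lambda>x. f x * sine_mode p q k x) has_integral I) {p..q}"
  shows "sine_coeff p q k f = 2 / (q - p) * I"
  using assms(2) by (simp add: sine_coeff_def integral_unique)

lemma sine_coeff_cong:
  assumes "\<And>x. x \<in> {p..q} \<Longrightarrow> f x = g x"
  shows "sine_coeff p q k f = sine_coeff p q k g"
  unfolding sine_coeff_def using assms by (auto intro!: arg_cong[where f = "\<lambda>x. _ * x"] integral_cong)

lemma sine_coeff_linear:
  assumes "p < q" and "continuous_on {p..q} f" and "continuous_on {p..q} g"
  shows "sine_coeff p q k (\<lambda>x. c * f x + d * g x) = c * sine_coeff p q k f + d * sine_coeff p q k g"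
proof -
  have "((\<lambda>x. c * (f x * sine_mode p q k x) + d * (g x * sine_mode p q k x)) has_integral
     c * ((q - p) / 2 * sine_coeff p q k f) + d * ((q - p) / 2 * sine_coeff p q k g)) {p..q}"
    by (intro has_integral_add has_integral_mult_right sine_coeff_has_integral assms)
  then have "((\<lambda>x. (c * f x + d * g x) * sine_mode p q k x) has_integral
     (q - p) / 2 * (c * sine_coeff p q k f + d * sine_coeff p q k g)) {p..q}"
    by (simp add: algebra_simps)
  from sine_coeff_unique[OF assms(1) this] show ?thesis using assms(1) by simp
qed

text \<open>The integral of the square of \<open>g\<close> minus its partial sine sum is nonnegative; by orthogonality it equals
  the integral of \<open>g\<^sup>2\<close> minus \<open>(q - p) / 2\<close> times the sum of the squared coefficients.\<close>
lemma bessel_inequality_sine: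
  assumes pq: "p < q" and cont: "continuous_on {p..q} g"
  shows "summable (\<lambda>k. (sine_coeff p q (Suc k) g)\<^sup>2)"
proof (rule summableI_nonneg_bounded)
  define d where "d = (q - p) / 2"
  have d: "0 < d" using pq by (simp add: d_def)
  define b where "b k = sine_coeff p q (Suc k) g" for k
  define S where "S n x = (\<Sum>k<n. b k * sine_mode p q (Suc k) x)" for n x
  fix n
  have gg: "((\<lambda>x. g x * g x) has_integral integral {p..q} (\<lambda>x. g x * g x)) {p..q}"
    by (intro integrable_integral integrable_continuous_interval continuous_intros cont)
  have gs: "((\<lambda>x. g x * sine_mode p q (Suc k) x) has_integral d * b k) {p..q}" for k
    unfolding d_def b_def by (rule sine_coeff_has_integral[OF pq cont])
  have "((\<lambda>x. \<Sum>k<n. b k * (g x * sine_mode p q (Suc k) x)) has_integral (\<Sum>k<n. b k * (d * b k))) {p..q}"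
    by (intro has_integral_sum has_integral_mult_right gs finite_lessThan)
  moreover have "(\<Sum>k<n. b k * (g x * sine_mode p q (Suc k) x)) = g x * S n x" for x
    unfolding S_def sum_distrib_left by (rule sum.cong) simp_all
  ultimately have gS: "((\<lambda>x. g x * S n x) has_integral (\<Sum>k<n. b k * (d * b k))) {p..q}" by simp
  have "((\<lambda>x. \<Sum>j<n. \<Sum>k<n. b j * b k * (sine_mode p q (Suc j) x * sine_mode p q (Suc k) x))
      has_integral (\<Sum>j<n. \<Sum>k<n. b j * b k * (if Suc j = Suc k then (q - p) / 2 else 0))) {p..q}"
    by (intro has_integral_sum has_integral_mult_right mode_orthogonality(2) finite_lessThan pq) simp
  moreover have "(\<Sum>j<n. \<Sum>k<n. b j * b k * (sine_mode p q (Suc j) x * sine_mode p q (Suc k) x)) = S n x * S n x" for x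
    unfolding S_def sum_product by (intro sum.cong refl) (simp add: ac_simps)
  moreover have "(\<Sum>j<n. \<Sum>k<n. b j * b k * (if Suc j = Suc k then (q - p) / 2 else 0)) = (\<Sum>k<n. b k * (d * b k))"
  proof (rule sum.cong)
    fix j assume "j \<in> {..<n}"
    then show "(\<Sum>k<n. b j * b k * (if Suc j = Suc k then (q - p) / 2 else 0)) = b j * (d * b j)"
      by (simp add: if_distrib d_def cong: if_cong)
  qed simp
  ultimately have SS: "((\<lambda>x. S n x * S n x) has_integral (\<Sum>k<n. b k * (d * b k))) {p..q}" by simp
  let ?B = "\<Sum>k<n. b k * (d * b k)"
  have "((\<lambda>x. g x * g x - 2 * (g x * S n x) + S n x * S n x) has_integral
      (integral {p..q} (\<lambda>x. g x * g x) - 2 * ?B + ?B)) {p..q}"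
    by (intro has_integral_add has_integral_diff has_integral_mult_right gg gS SS)
  moreover have "g x * g x - 2 * (g x * S n x) + S n x * S n x = (g x - S n x)\<^sup>2" for x
    by (simp add: power2_eq_square algebra_simps)
  ultimately have "((\<lambda>x. (g x - S n x)\<^sup>2) has_integral (integral {p..q} (\<lambda>x. g x * g x) - ?B)) {p..q}"
    by simp
  then have "0 \<le> integral {p..q} (\<lambda>x. g x * g x) - ?B"
    by (rule has_integral_nonneg) simp
  moreover have "?B = d * (\<Sum>k<n. (sine_coeff p q (Suc k) g)\<^sup>2)"
    unfolding sum_distrib_left by (rule sum.cong) (simp_all add: b_def power2_eq_square)
  ultimately show "(\<Sum>k<n. (sine_coeff p q (Suc k) g)\<^sup>2) \<le> integral {p..q} (\<lambda>x. g x * g x) / d"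
    using d by (simp add: field_simps)
qed simp

text \<open>Two integrations by parts, in the form of the antiderivative \<open>f' s - f s'\<close> of \<open>f'' s - f s''\<close>: the first boundary term vanishes
  with the sine mode, the second one with \<open>f\<close>.\<close>
lemma sine_coeff_second_derivative:
  assumes pq: "p < q"
    and f1: "\<And>x. x \<in> {p..q} \<Longrightarrow> (f has_real_derivative f1 x) (at x within {p..q})"
    and f2: "\<And>x. x \<in> {p..q} \<Longrightarrow> (f1 has_real_derivative f2 x) (at x within {p..q})"
    and cont: "continuous_on {p..q} f2" and ends: "f p = 0" "f q = 0"
  shows "sine_coeff p q k f2 = - (wave_number p q k)\<^sup>2 * sine_coeff p q k f"
proof -
  let ?w = "wave_number p q k" and ?s = "sine_mode p q k" and ?c = "cosine_mode p q k"
  let ?F = "\<lambda>x. f1 x * ?s x - f x * (?w * ?c x)"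
  have "((\<lambda>x. f2 x * ?s x + ?w\<^sup>2 * (f x * ?s x)) has_integral ?F q - ?F p) {p..q}"
  proof (rule fundamental_theorem_of_calculus)
    fix x assume x: "x \<in> {p..q}"
    show "(?F has_vector_derivative f2 x * ?s x + ?w\<^sup>2 * (f x * ?s x)) (at x within {p..q})"
      unfolding has_real_derivative_iff_has_vector_derivative[symmetric]
      by (auto intro!: derivative_eq_intros f1[OF x] f2[OF x] simp: power2_eq_square algebra_simps)
  qed (use pq in simp)
  then have "((\<lambda>x. f2 x * ?s x + ?w\<^sup>2 * (f x * ?s x)) has_integral 0) {p..q}"
    using pq by (simp add: sine_mode_ends ends)
  moreover have "continuous_on {p..q} f" using f1 by (rule DERIV_continuous_on)
  then have "((\<lambda>x. f2 x * ?s x + ?w\<^sup>2 * (f x * ?s x)) has_integral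
      ((q - p) / 2 * sine_coeff p q k f2 + ?w\<^sup>2 * ((q - p) / 2 * sine_coeff p q k f))) {p..q}"
    by (intro has_integral_add has_integral_mult_right sine_coeff_has_integral pq cont)
  ultimately have "(q - p) / 2 * sine_coeff p q k f2 + ?w\<^sup>2 * ((q - p) / 2 * sine_coeff p q k f) = 0"
    by (rule has_integral_unique[symmetric])
  then have "(q - p) / 2 * (sine_coeff p q k f2 + ?w\<^sup>2 * sine_coeff p q k f) = 0"
    by (simp add: algebra_simps)
  then show ?thesis using pq by simp
qed

text \<open>The coefficients of \<open>f''\<close> are square summable but not absolutely summable in general, since \<open>f''\<close> is merely
  continuous. This suffices: \<open>wave_number * sine_coeff f\<close> is, up to sign, \<open>sine_coeff f''\<close> divided by
  the wave number, a product of two square summable sequences.\<close>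
lemma sine_coeff_summable:
  assumes pq: "p < q"
    and f1: "\<And>x. x \<in> {p..q} \<Longrightarrow> (f has_real_derivative f1 x) (at x within {p..q})"
    and f2: "\<And>x. x \<in> {p..q} \<Longrightarrow> (f1 has_real_derivative f2 x) (at x within {p..q})"
    and cont: "continuous_on {p..q} f2" and ends: "f p = 0" "f q = 0"
  shows "summable (\<lambda>k. wave_number p q (Suc k) * \<bar>sine_coeff p q (Suc k) f\<bar>)"
proof (rule summable_comparison_test')
  let ?w = "\<lambda>k. wave_number p q (Suc k)"
  have "summable (\<lambda>k. ((q - p) / pi)\<^sup>2 * inverse (real (Suc k) ^ 2))"
    using inverse_power_summable[of 2, where 'a = real] by (intro summable_mult, subst summable_Suc_iff) simp
  moreover have "((q - p) / pi)\<^sup>2 * inverse (real (Suc k) ^ 2) = (1 / ?w k)\<^sup>2" for k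
    by (simp add: wave_number_def power_divide power_mult_distrib field_simps del: of_nat_Suc)
  ultimately have "summable (\<lambda>k. (1 / ?w k)\<^sup>2)" by (simp only:)
  then show "summable (\<lambda>k. ((sine_coeff p q (Suc k) f2)\<^sup>2 + (1 / ?w k)\<^sup>2) / 2)"
    by (intro summable_divide summable_add bessel_inequality_sine pq cont)
  fix k
  have w: "0 < ?w k" using wave_number_pos[OF pq] by simp
  have "sine_coeff p q (Suc k) f2 = - (?w k)\<^sup>2 * sine_coeff p q (Suc k) f"
    by (rule sine_coeff_second_derivative[OF pq f1 f2 cont ends])
  then have "?w k * \<bar>sine_coeff p q (Suc k) f\<bar> = \<bar>sine_coeff p q (Suc k) f2\<bar> * (1 / ?w k)"
    using w by (simp add: abs_mult power2_eq_square)
  also have "\<dots> \<le> (\<bar>sine_coeff p q (Suc k) f2\<bar>\<^sup>2 + (1 / ?w k)\<^sup>2) / 2"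
    using sum_squares_bound[of "\<bar>sine_coeff p q (Suc k) f2\<bar>" "1 / ?w k"] by (simp add: mult.commute)
  finally show "norm (?w k * \<bar>sine_coeff p q (Suc k) f\<bar>) \<le> ((sine_coeff p q (Suc k) f2)\<^sup>2 + (1 / ?w k)\<^sup>2) / 2"
    using w by (simp add: abs_mult)
qed

text \<open>The differentiated series converges uniformly to a continuous \<open>T\<close>. Integration by parts shows that \<open>T\<close> and
  \<open>f'\<close> have the same cosine moments, including the zeroth one, since the integral of \<open>f'\<close> is \<open>f q - f p = 0\<close>.
  Completeness gives \<open>f' = T\<close>, also at the end points, and the series of \<open>f\<close> follows by integration from \<open>p\<close>.\<close>
lemma sine_series_expansion:
  assumes pq: "p < q"
    and f1: "\<And>x. x \<in> {p..q} \<Longrightarrow> (f has_real_derivative f1 x) (at x within {p..q})"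
    and cont: "continuous_on {p..q} f1" and ends: "f p = 0" "f q = 0"
    and sm: "summable (\<lambda>k. wave_number p q (Suc k) * \<bar>sine_coeff p q (Suc k) f\<bar>)"
    and x: "x \<in> {p..q}"
  shows "(\<lambda>k. sine_coeff p q k f * sine_mode p q k x) sums\<^sub>1 f x"
    and "(\<lambda>k. sine_coeff p q k f * deriv (sine_mode p q k) x) sums\<^sub>1 f1 x"
proof -
  define w where "w k = wave_number p q (Suc k)" for k
  define a where "a k = sine_coeff p q (Suc k) f" for k
  define s where "s k = sine_mode p q (Suc k)" for k
  define c where "c k = cosine_mode p q (Suc k)" for k
  define T where "T x = (\<Sum>k. a k * (w k * c k x))" for x
  have M: "summable (\<lambda>k. w k * \<bar>a k\<bar>)" using sm by (simp add: w_def a_def)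
  have w: "0 \<le> w k" for k unfolding w_def by (rule wave_number_nonneg[OF pq])
  have bound: "norm (a k * (w k * c k x)) \<le> w k * \<bar>a k\<bar>" for k x
    using mult_left_mono[OF abs_modes_le_1(2)[of p q "Suc k" x], of "w k * \<bar>a k\<bar>"] w[of k]
    by (simp add: c_def abs_mult ac_simps)
  have c_cont: "continuous_on {p..q} (c k)" for k unfolding c_def by (rule continuous_on_modes)
  have unif: "uniform_limit {p..q} (\<lambda>n x. \<Sum>k<n. a k * (w k * c k x)) T sequentially"
    unfolding T_def by (rule Weierstrass_m_test[OF bound M])
  have T_cont: "continuous_on {p..q} T"
    by (rule uniform_limit_theorem[OF _ unif])
      (auto intro!: always_eventually continuous_intros c_cont)
  have T_sums: "(\<lambda>k. a k * (w k * c k y)) sums T y" for y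
    unfolding T_def by (rule summable_sums[OF summable_comparison_test'[OF M bound]])
  have f_cont: "continuous_on {p..q} f" using f1 by (rule DERIV_continuous_on)
  have T_moment: "((\<lambda>x. T x * cosine_mode p q j x) has_integral
      (wave_number p q j * ((q - p) / 2 * sine_coeff p q j f))) {p..q}" for j
  proof -
    let ?h = "\<lambda>k x. a k * (w k * c k x) * cosine_mode p q j x"
    have "norm (?h k x) \<le> w k * \<bar>a k\<bar>" for k x
      using mult_mono[OF bound[of k x] abs_modes_le_1(2)[of p q j x]] w[of k] by (simp add: abs_mult)
    from Weierstrass_m_test[OF this M]
    have "uniform_limit {p..q} (\<lambda>n x. \<Sum>k<n. ?h k x) (\<lambda>x. \<Sum>k. ?h k x) sequentially" .
    moreover have "(\<Sum>k. ?h k x) = T x * cosine_mode p q j x" for x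
      using sums_mult2[OF T_sums[of x], of "cosine_mode p q j x"] by (simp add: sums_iff)
    ultimately have "uniform_limit {p..q} (\<lambda>n x. \<Sum>k<n. ?h k x) (\<lambda>x. T x * cosine_mode p q j x) sequentially"
      by simp
    moreover have "continuous_on {p..q} (\<lambda>x. \<Sum>k<n. ?h k x)" for n
      by (intro continuous_intros c_cont)
    ultimately obtain I J where I: "\<And>n. ((\<lambda>x. \<Sum>k<n. ?h k x) has_integral I n) {p..q}"
      and J: "((\<lambda>x. T x * cosine_mode p q j x) has_integral J) {p..q}" and lim: "I \<longlonglongrightarrow> J"
      by (rule uniform_limit_integral) auto
    have "((\<lambda>x. \<Sum>k<n. a k * w k * (cosine_mode p q j x * c k x)) has_integral
        (\<Sum>k<n. a k * w k * (if j = Suc k then (q - p) / 2 else 0))) {p..q}" for n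
      unfolding c_def by (intro has_integral_sum has_integral_mult_right mode_orthogonality(1) pq) auto
    moreover have "(\<Sum>k<n. a k * w k * (cosine_mode p q j x * c k x)) = (\<Sum>k<n. ?h k x)" for n x
      by (intro sum.cong refl) simp
    ultimately have "((\<lambda>x. \<Sum>k<n. ?h k x) has_integral
        (\<Sum>k<n. a k * w k * (if j = Suc k then (q - p) / 2 else 0))) {p..q}" for n
      by simp
    then have I_eq: "I n = (\<Sum>k<n. a k * w k * (if j = Suc k then (q - p) / 2 else 0))" for n
      using I has_integral_unique by blast
    have "I n = wave_number p q j * ((q - p) / 2 * sine_coeff p q j f)" if "j \<le> n" for n
    proof (cases j)
      case 0
      then show ?thesis unfolding I_eq by (simp add: wave_number_def)
    next
      case (Suc i)
      then have "I n = (\<Sum>k<n. if k = i then a k * w k * ((q - p) / 2) else 0)"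
        unfolding I_eq by (intro sum.cong) auto
      also have "\<dots> = a i * w i * ((q - p) / 2)" using that Suc by (subst sum.delta) auto
      finally show ?thesis by (simp add: a_def w_def Suc)
    qed
    then have "I \<longlonglongrightarrow> wave_number p q j * ((q - p) / 2 * sine_coeff p q j f)"
      by (intro tendsto_eventually) (auto simp: eventually_sequentially)
    with lim have "J = wave_number p q j * ((q - p) / 2 * sine_coeff p q j f)"
      by (rule LIMSEQ_unique)
    then show ?thesis using J by (simp only:)
  qed
  have f1_moment: "((\<lambda>x. f1 x * cosine_mode p q j x) has_integral
      (wave_number p q j * ((q - p) / 2 * sine_coeff p q j f))) {p..q}" for j
  proof -
    let ?G = "\<lambda>x. f x * cosine_mode p q j x"
    have "((\<lambda>x. f1 x * cosine_mode p q j x - wave_number p q j * (f x * sine_mode p q j x))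
        has_integral ?G q - ?G p) {p..q}"
    proof (rule fundamental_theorem_of_calculus)
      fix y assume y: "y \<in> {p..q}"
      show "(?G has_vector_derivative f1 y * cosine_mode p q j y - wave_number p q j * (f y * sine_mode p q j y))
          (at y within {p..q})"
        unfolding has_real_derivative_iff_has_vector_derivative[symmetric]
        by (auto intro!: derivative_eq_intros f1[OF y])
    qed (use pq in simp)
    from has_integral_add[OF this has_integral_mult_right[OF sine_coeff_has_integral[OF pq f_cont, of j],
        of "wave_number p q j"]]
    show ?thesis using ends by simp
  qed
  have f1_T: "f1 y = T y" if "y \<in> {p..q}" for y
  proof -
    have "integral {p..q} (\<lambda>x. (f1 x - T x) * cosine_mode p q j x) = 0" for j
      using has_integral_diff[OF f1_moment[of j] T_moment[of j]]
      by (simp add: left_diff_distrib integral_unique)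
    from cosine_system_complete[OF pq continuous_on_diff[OF cont T_cont] this that] show ?thesis by simp
  qed
  show "(\<lambda>k. sine_coeff p q k f * deriv (sine_mode p q k) x) sums\<^sub>1 f1 x"
    using T_sums[of x] f1_T[OF x] by (simp add: sums_from_1_def deriv_sine_mode a_def w_def c_def)
  have "\<exists>G. \<forall>y\<in>{p..q}. (\<lambda>k. a k * s k y) sums G y \<and> (G has_real_derivative T y) (at y within {p..q})"
  proof (rule has_field_derivative_series[OF _ _ unif])
    show "((\<lambda>x. a k * s k x) has_real_derivative a k * (w k * c k y)) (at y within {p..q})" for k y
      unfolding s_def w_def c_def by (auto intro!: derivative_eq_intros)
    show "p \<in> {p..q}" using pq by simp
    show "summable (\<lambda>k. a k * s k p)" using pq by (simp add: s_def sine_mode_ends)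
  qed simp
  then obtain G where G: "\<And>y. y \<in> {p..q} \<Longrightarrow> (\<lambda>k. a k * s k y) sums G y"
    and G': "\<And>y. y \<in> {p..q} \<Longrightarrow> (G has_real_derivative T y) (at y within {p..q})" by blast
  have "((\<lambda>y. f y - G y) has_real_derivative 0) (at y within {p..q})" if "y \<in> {p..q}" for y
    using DERIV_diff[OF f1[OF that] G'[OF that]] f1_T[OF that] by simp
  from has_field_derivative_zero_constant[OF convex_real_interval(5) this]
  obtain C where C: "\<And>y. y \<in> {p..q} \<Longrightarrow> f y - G y = C" by blast
  have "(\<lambda>k. a k * s k p) sums 0" using pq by (simp add: s_def sine_mode_ends)
  then have "G p = 0" using G[of p] pq sums_unique2 by fastforce
  then have "C = 0" using C[of p] pq ends by simp
  then have "f x = G x" using C[OF x] by simp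
  then show "(\<lambda>k. sine_coeff p q k f * sine_mode p q k x) sums\<^sub>1 f x"
    using G[OF x] by (simp add: sums_from_1_def a_def s_def)
qed

section \<open>Sine modes of a wave with prescribed boundary values\<close>

lemma continuous_on_of_derivative:
  fixes f :: "real \<Rightarrow> real"
  assumes "\<And>x. (f has_real_derivative f' x) (at x)"
  shows "continuous_on S f"
  by (rule DERIV_continuous_on[OF has_field_derivative_at_within[OF assms]])

text \<open>Duhamel's formula holds for every twice differentiable \<open>V\<close>, with \<open>V'' + w\<^sup>2 V\<close> as the forcing term. It is
  the fundamental theorem of calculus for \<open>s \<mapsto> V' s sin (w (t - s)) / w + V s cos (w (t - s))\<close>.\<close>
lemma oscillator_variation_of_constants:
  assumes w: "w \<noteq> 0" and t: "0 \<le> t"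
    and V1: "\<And>s. 0 \<le> s \<Longrightarrow> (V has_real_derivative V1 s) (at s within {0..})"
    and V2: "\<And>s. 0 \<le> s \<Longrightarrow> (V1 has_real_derivative V2 s) (at s within {0..})"
  shows "V t = V 0 * cos (w * t) + V1 0 / w * sin (w * t)
           + integral {0..t} (\<lambda>s. (V2 s + w\<^sup>2 * V s) / w * sin (w * (t - s)))"
proof -
  let ?F = "\<lambda>s. V1 s / w * sin (w * (t - s)) + V s * cos (w * (t - s))"
  have "((\<lambda>s. (V2 s + w\<^sup>2 * V s) / w * sin (w * (t - s))) has_integral ?F t - ?F 0) {0..t}"
  proof (rule fundamental_theorem_of_calculus[OF t])
    fix s assume s: "s \<in> {0..t}"
    have V1': "(V has_real_derivative V1 s) (at s within {0..t})"
      by (rule DERIV_subset[OF V1]) (use s in auto)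
    have V2': "(V1 has_real_derivative V2 s) (at s within {0..t})"
      by (rule DERIV_subset[OF V2]) (use s in auto)
    show "(?F has_vector_derivative (V2 s + w\<^sup>2 * V s) / w * sin (w * (t - s))) (at s within {0..t})"
      unfolding has_real_derivative_iff_has_vector_derivative[symmetric]
      using w by (auto intro!: derivative_eq_intros V1' V2' simp: power2_eq_square field_simps)
  qed
  from integral_unique[OF this] show ?thesis by simp
qed

text \<open>The expressions \<open>P\<^sub>k cos + Q\<^sub>k sin\<close> and \<open>R\<^sub>k\<close> on a general interval and for a general affine lift \<open>e\<close>, so that
  both segments are treated at once.\<close>
definition free_mode :: "real \<Rightarrow> real \<Rightarrow> real \<Rightarrow> (real \<Rightarrow> real) \<Rightarrow> (real \<Rightarrow> real) \<Rightarrow> nat \<Rightarrow> real \<Rightarrow> real" where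
  "free_mode a p q f g k t = sine_coeff p q k f * cos (real k * pi * a / (q - p) * t)
     + sine_coeff p q k g / (real k * pi * a / (q - p)) * sin (real k * pi * a / (q - p) * t)"

definition forced_mode :: "real \<Rightarrow> real \<Rightarrow> real \<Rightarrow> (real \<Rightarrow> real) \<Rightarrow> (real \<Rightarrow> real) \<Rightarrow> nat \<Rightarrow> real \<Rightarrow> real" where
  "forced_mode a p q e h k t = integral {0..t} (\<lambda>\<tau>.
     sine_coeff p q k (\<lambda>x. - e x * deriv_on {0..} 2 h \<tau>) / (real k * pi * a / (q - p))
       * sin (real k * pi * a / (q - p) * (t - \<tau>)))"

text \<open>A classical wave \<open>v\<close> on one segment with boundary values \<open>e h\<close>. It is assumed to be smooth for all
  \<open>x\<close> and \<open>t\<close>, so that only two-sided derivatives occur, whereas \<open>u\<close> agrees with it on the segment and for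
  nonnegative times only. In the end \<open>u\<close> is glued from two such waves.\<close>
locale segment_wave =
  fixes a p q e' :: real and e h h1 h2 \<phi> \<psi> :: "real \<Rightarrow> real" and u v vx vxx vt vtt :: "real \<Rightarrow> real \<Rightarrow> real"
  assumes pq: "p < q" and a: "0 < a"
    and vx: "\<And>x t. ((\<lambda>x. v x t) has_real_derivative vx x t) (at x)"
    and vxx: "\<And>x t. ((\<lambda>x. vx x t) has_real_derivative vxx x t) (at x)"
    and vt: "\<And>x t. ((\<lambda>t. v x t) has_real_derivative vt x t) (at t)"
    and vtt: "\<And>x t. ((\<lambda>t. vt x t) has_real_derivative vtt x t) (at t)"
    and wave: "\<And>x t. vtt x t = a\<^sup>2 * vxx x t"
    and vt_cont: "continuous_on UNIV (\<lambda>(t, x). vt x t)"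
    and vtt_cont: "continuous_on UNIV (\<lambda>(t, x). vtt x t)"
    and h1: "\<And>t. (h has_real_derivative h1 t) (at t)"
    and h2: "\<And>t. (h1 has_real_derivative h2 t) (at t)"
    and h2_cont: "continuous_on UNIV h2"
    and e': "\<And>x. (e has_real_derivative e') (at x)"
    and ends: "\<And>t. 0 \<le> t \<Longrightarrow> v p t = e p * h t" "\<And>t. 0 \<le> t \<Longrightarrow> v q t = e q * h t"
    and u: "\<And>x t. x \<in> {p..q} \<Longrightarrow> 0 \<le> t \<Longrightarrow> u x t = v x t"
    and init: "\<And>x. x \<in> {p..q} \<Longrightarrow> v x 0 = \<phi> x" "\<And>x. x \<in> {p..q} \<Longrightarrow> vt x 0 = \<psi> x"
begin

abbreviation "\<omega> k \<equiv> real k * pi * a / (q - p)"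

definition "W k t = sine_coeff p q k (\<lambda>x. v x t - e x * h t)"
definition "W1 k t = sine_coeff p q k (\<lambda>x. vt x t - e x * h1 t)"
definition "W2 k t = sine_coeff p q k (\<lambda>x. vtt x t - e x * h2 t)"

lemma h1_cont: "continuous_on S h1"
  by (rule continuous_on_of_derivative) (rule h2)

lemma e_cont: "continuous_on S e"
  by (rule continuous_on_of_derivative) (rule e')

lemma v_cont_x: "continuous_on S (\<lambda>x. v x t)" and vx_cont_x: "continuous_on S (\<lambda>x. vx x t)"
  by (rule continuous_on_of_derivative, rule vx vxx)+

lemma vtt_cont_x: "continuous_on S (\<lambda>x. vtt x t)"
  using continuous_on_compose2[OF vtt_cont continuous_on_Pair[OF continuous_on_const[of S t] continuous_on_id]]
  by simp

lemma vt_cont_x: "continuous_on S (\<lambda>x. vt x t)"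
  using continuous_on_compose2[OF vt_cont continuous_on_Pair[OF continuous_on_const[of S t] continuous_on_id]]
  by simp

lemma vxx_cont_x: "continuous_on S (\<lambda>x. vxx x t)"
proof -
  have "continuous_on S (\<lambda>x. vtt x t / a\<^sup>2)"
    by (intro continuous_intros vtt_cont_x) (use a in simp)
  then show ?thesis using wave a by simp
qed

text \<open>Joint continuity of the integrands, as required for differentiation under the integral sign.\<close>
lemma lifted_cont:
  assumes "continuous_on UNIV (\<lambda>(t, x). f x t)" and "continuous_on UNIV g"
  shows "continuous_on S (\<lambda>(t, x). (f x t - e x * g t) * sine_mode p q k x)"
proof -
  have "continuous_on S (\<lambda>z. f (snd z) (fst z))"
    using continuous_on_subset[OF assms(1)] by (simp add: case_prod_beta)
  then have "continuous_on S (\<lambda>z. (f (snd z) (fst z) - e (snd z) * g (fst z)) * sine_mode p q k (snd z))"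
    by (intro continuous_on_mult continuous_on_diff
        continuous_on_compose2[OF e_cont continuous_on_snd[OF continuous_on_id] subset_UNIV]
        continuous_on_compose2[OF assms(2) continuous_on_fst[OF continuous_on_id] subset_UNIV]
        continuous_on_compose2[OF continuous_on_modes(1) continuous_on_snd[OF continuous_on_id] subset_UNIV])
  then show ?thesis by (simp add: case_prod_beta)
qed

lemma W_has_derivative: "(W k has_real_derivative W1 k t) (at t)"
proof -
  have "((\<lambda>t. integral (cbox p q) (\<lambda>x. (v x t - e x * h t) * sine_mode p q k x)) has_real_derivative
      integral (cbox p q) (\<lambda>x. (vt x t - e x * h1 t) * sine_mode p q k x)) (at t within UNIV)"
  proof (rule leibniz_rule_field_derivative)
    show "((\<lambda>t. (v x t - e x * h t) * sine_mode p q k x) has_real_derivative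
        (vt x t - e x * h1 t) * sine_mode p q k x) (at t within UNIV)" for t x
      by (auto intro!: derivative_eq_intros vt h1)
    show "(\<lambda>x. (v x t - e x * h t) * sine_mode p q k x) integrable_on cbox p q" for t
      by (intro integrable_continuous continuous_intros v_cont_x e_cont)
  qed (auto intro!: lifted_cont vt_cont h1_cont)
  then have "((\<lambda>t. integral {p..q} (\<lambda>x. (v x t - e x * h t) * sine_mode p q k x)) has_real_derivative
      integral {p..q} (\<lambda>x. (vt x t - e x * h1 t) * sine_mode p q k x)) (at t)"
    by simp
  then show ?thesis
    unfolding W_def[abs_def] W1_def sine_coeff_def by (rule DERIV_cmult)
qed

lemma W1_has_derivative: "(W1 k has_real_derivative W2 k t) (at t)"
proof -
  have "((\<lambda>t. integral (cbox p q) (\<lambda>x. (vt x t - e x * h1 t) * sine_mode p q k x)) has_real_derivative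
      integral (cbox p q) (\<lambda>x. (vtt x t - e x * h2 t) * sine_mode p q k x)) (at t within UNIV)"
  proof (rule leibniz_rule_field_derivative)
    show "((\<lambda>t. (vt x t - e x * h1 t) * sine_mode p q k x) has_real_derivative
        (vtt x t - e x * h2 t) * sine_mode p q k x) (at t within UNIV)" for t x
      by (auto intro!: derivative_eq_intros vtt h2)
    show "(\<lambda>x. (vt x t - e x * h1 t) * sine_mode p q k x) integrable_on cbox p q" for t
      by (intro integrable_continuous continuous_intros vt_cont_x e_cont)
  qed (auto intro!: lifted_cont vtt_cont h2_cont)
  then have "((\<lambda>t. integral {p..q} (\<lambda>x. (vt x t - e x * h1 t) * sine_mode p q k x)) has_real_derivative
      integral {p..q} (\<lambda>x. (vtt x t - e x * h2 t) * sine_mode p q k x)) (at t)"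
    by simp
  then show ?thesis
    unfolding W1_def[abs_def] W2_def sine_coeff_def by (rule DERIV_cmult)
qed

lemma W2_cont: "continuous_on S (W2 k)"
proof -
  have "continuous_on UNIV (\<lambda>t. integral (cbox p q) (\<lambda>x. (vtt x t - e x * h2 t) * sine_mode p q k x))"
    by (rule integral_continuous_on_param) (rule lifted_cont[OF vtt_cont h2_cont])
  then have "continuous_on UNIV (W2 k)"
    unfolding W2_def[abs_def] sine_coeff_def by (intro continuous_on_mult continuous_on_const) simp
  then show ?thesis by (rule continuous_on_subset) simp
qed

lemma lifted_x_derivatives:
  "((\<lambda>x. v x t - e x * h t) has_real_derivative vx x t - e' * h t) (at x within {p..q})"
  "((\<lambda>x. vx x t - e' * h t) has_real_derivative vxx x t) (at x within {p..q})"
proof -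
  show "((\<lambda>x. v x t - e x * h t) has_real_derivative vx x t - e' * h t) (at x within {p..q})"
    by (intro DERIV_diff DERIV_cmult_right has_field_derivative_at_within[OF vx] has_field_derivative_at_within[OF e'])
  show "((\<lambda>x. vx x t - e' * h t) has_real_derivative vxx x t) (at x within {p..q})"
    using DERIV_diff[OF has_field_derivative_at_within[OF vxx, of t x "{p..q}"] DERIV_const[of "e' * h t"]] by simp
qed

lemma lifted_ends: "0 \<le> t \<Longrightarrow> v p t - e p * h t = 0" "0 \<le> t \<Longrightarrow> v q t - e q * h t = 0"
  using ends by simp_all

text \<open>The lifted wave \<open>v - e h\<close> vanishes at the end points, and \<open>e\<close> is affine, so two integrations by parts turn
  \<open>a\<^sup>2 v\<^sub>x\<^sub>x\<close> into \<open>- \<omega>\<^sup>2\<close> times the coefficient of \<open>v - e h\<close>.\<close>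
lemma W_oscillator:
  assumes t: "0 \<le> t"
  shows "W2 k t + (\<omega> k)\<^sup>2 * W k t = sine_coeff p q k (\<lambda>x. - e x * h2 t)"
proof -
  have "W2 k t = a\<^sup>2 * sine_coeff p q k (\<lambda>x. vxx x t) + h2 t * sine_coeff p q k (\<lambda>x. - e x)"
    using sine_coeff_linear[OF pq vxx_cont_x continuous_on_minus[OF e_cont], of k "a\<^sup>2" t "h2 t"]
    by (simp add: W2_def wave ac_simps)
  also have "sine_coeff p q k (\<lambda>x. vxx x t) = - (wave_number p q k)\<^sup>2 * W k t"
    unfolding W_def
    by (rule sine_coeff_second_derivative[OF pq lifted_x_derivatives vxx_cont_x lifted_ends[OF t]])
  also have "h2 t * sine_coeff p q k (\<lambda>x. - e x) = sine_coeff p q k (\<lambda>x. - e x * h2 t)"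
    using sine_coeff_linear[OF pq continuous_on_minus[OF e_cont] continuous_on_const, of k "h2 t" 0 0]
    by (simp add: ac_simps)
  finally show ?thesis
    by (simp add: wave_number_def power_divide power_mult_distrib ac_simps)
qed

lemma V_coeff_eq_W: "0 \<le> t \<Longrightarrow> V_coeff p q e h u k t = W k t"
  unfolding V_coeff_def W_def by (rule sine_coeff_cong) (simp add: u)

lemma deriv_on_h:
  "C_on 2 {0..} h" "0 \<le> t \<Longrightarrow> deriv_on {0..} 1 h t = h1 t" "0 \<le> t \<Longrightarrow> deriv_on {0..} 2 h t = h2 t"
  using deriv_on_half_line[of h h, OF _ has_field_derivative_at_within[OF h1] has_field_derivative_at_within[OF h2]
      continuous_on_subset[OF h2_cont subset_UNIV]] by blast+

lemma V_coeff_initial: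
  "W k 0 = sine_coeff p q k (\<lambda>x. \<phi> x - e x * h 0)"
  "W1 k 0 = sine_coeff p q k (\<lambda>x. \<psi> x - e x * deriv_on {0..} 1 h 0)"
  unfolding W_def W1_def by (rule sine_coeff_cong; simp add: init deriv_on_h(2) del: One_nat_def)+

theorem formal_wave_ivp: "formal_wave_ivp a p q e \<phi> \<psi> h u"
  unfolding formal_wave_ivp_def
proof (intro allI impI)
  fix k
  note D = deriv_on_half_line[of "V_coeff p q e h u k" "W k" "W1 k" "W2 k", OF _
      has_field_derivative_at_within[OF W_has_derivative] has_field_derivative_at_within[OF W1_has_derivative] W2_cont]
  have eq: "\<forall>t\<ge>0. V_coeff p q e h u k t = W k t" using V_coeff_eq_W by blast
  note D = D[OF eq]
  show "C_on 2 {0..} (V_coeff p q e h u k) \<and>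
    (\<forall>t\<ge>0. deriv_on {0..} 2 (V_coeff p q e h u k) t + (\<omega> k)\<^sup>2 * V_coeff p q e h u k t
       = sine_coeff p q k (\<lambda>x. - e x * deriv_on {0..} 2 h t)) \<and>
    V_coeff p q e h u k 0 = sine_coeff p q k (\<lambda>x. \<phi> x - e x * h 0) \<and>
    deriv_on {0..} 1 (V_coeff p q e h u k) 0 = sine_coeff p q k (\<lambda>x. \<psi> x - e x * deriv_on {0..} 1 h 0)"
  proof (intro conjI allI impI)
    show "C_on 2 {0..} (V_coeff p q e h u k)" by (rule D(1))
    show "V_coeff p q e h u k 0 = sine_coeff p q k (\<lambda>x. \<phi> x - e x * h 0)"
      using V_coeff_eq_W[of 0 k] V_coeff_initial(1)[of k] by simp
    show "deriv_on {0..} 1 (V_coeff p q e h u k) 0 = sine_coeff p q k (\<lambda>x. \<psi> x - e x * deriv_on {0..} 1 h 0)"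
      using D(2)[of 0] V_coeff_initial(2)[of k] by simp
    fix t :: real assume t: "0 \<le> t"
    show "deriv_on {0..} 2 (V_coeff p q e h u k) t + (\<omega> k)\<^sup>2 * V_coeff p q e h u k t
       = sine_coeff p q k (\<lambda>x. - e x * deriv_on {0..} 2 h t)"
      unfolding D(3)[OF t] V_coeff_eq_W[OF t] deriv_on_h(3)[OF t] by (rule W_oscillator[OF t])
  qed
qed

lemma V_coeff_split:
  assumes k: "1 \<le> k" and t: "0 \<le> t"
  shows "V_coeff p q e h u k t
    = free_mode a p q (\<lambda>x. \<phi> x - e x * h 0) (\<lambda>x. \<psi> x - e x * deriv_on {0..} 1 h 0) k t + forced_mode a p q e h k t"
proof -
  have "\<omega> k \<noteq> 0" using k pq a by simp
  from oscillator_variation_of_constants[OF this t has_field_derivative_at_within[OF W_has_derivative]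
      has_field_derivative_at_within[OF W1_has_derivative], of k]
  have "W k t = free_mode a p q (\<lambda>x. \<phi> x - e x * h 0) (\<lambda>x. \<psi> x - e x * deriv_on {0..} 1 h 0) k t
      + integral {0..t} (\<lambda>s. (W2 k s + (\<omega> k)\<^sup>2 * W k s) / \<omega> k * sin (\<omega> k * (t - s)))"
    unfolding free_mode_def V_coeff_initial by simp
  also have "integral {0..t} (\<lambda>s. (W2 k s + (\<omega> k)\<^sup>2 * W k s) / \<omega> k * sin (\<omega> k * (t - s)))
      = forced_mode a p q e h k t"
    unfolding forced_mode_def by (rule integral_cong) (simp add: W_oscillator deriv_on_h)
  finally show ?thesis using V_coeff_eq_W[OF t] by simp
qed

lemma W_summable: "0 \<le> t \<Longrightarrow> summable (\<lambda>k. wave_number p q (Suc k) * \<bar>W (Suc k) t\<bar>)"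
  unfolding W_def
  by (rule sine_coeff_summable[OF pq lifted_x_derivatives vxx_cont_x lifted_ends])

lemma sine_series:
  assumes t: "0 \<le> t" and x: "x \<in> {p..q}"
  shows "(\<lambda>k. V_coeff p q e h u k t * sine_mode p q k x) sums\<^sub>1 (u x t - e x * h t)"
    and "(\<lambda>k. V_coeff p q e h u k t * deriv (sine_mode p q k) x) sums\<^sub>1 (vx x t - e' * h t)"
proof -
  have c: "continuous_on {p..q} (\<lambda>x. vx x t - e' * h t)"
    by (intro continuous_intros vx_cont_x)
  note S = sine_series_expansion[OF pq lifted_x_derivatives(1) c lifted_ends[OF t] W_summable[OF t, unfolded W_def] x]
  show "(\<lambda>k. V_coeff p q e h u k t * sine_mode p q k x) sums\<^sub>1 (u x t - e x * h t)"
    using S(1) u[OF x t] V_coeff_eq_W[OF t] by (simp add: W_def)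
  show "(\<lambda>k. V_coeff p q e h u k t * deriv (sine_mode p q k) x) sums\<^sub>1 (vx x t - e' * h t)"
    using S(2) V_coeff_eq_W[OF t] by (simp add: W_def)
qed

lemma series_value: "0 \<le> t \<Longrightarrow> x \<in> {p..q} \<Longrightarrow> series_value p q e h u t x (u x t)"
  unfolding series_value_def by (rule sine_series)

lemma series_slope: "0 \<le> t \<Longrightarrow> x \<in> {p..q} \<Longrightarrow> series_slope p q e h u t x (vx x t)"
  unfolding series_slope_def DERIV_imp_deriv[OF e'] by (rule sine_series)

lemma free_mode_summable:
  assumes psi: "summable (\<lambda>k. \<bar>sine_coeff p q (Suc k) (\<lambda>x. \<psi> x - e x * deriv_on {0..} 1 h 0)\<bar>)"
  shows "summable (\<lambda>k. wave_number p q (Suc k) *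
    \<bar>free_mode a p q (\<lambda>x. \<phi> x - e x * h 0) (\<lambda>x. \<psi> x - e x * deriv_on {0..} 1 h 0) (Suc k) t\<bar>)"
proof (rule summable_comparison_test')
  let ?w = "\<lambda>k. wave_number p q (Suc k)"
  show "summable (\<lambda>k. ?w k * \<bar>W (Suc k) 0\<bar> + \<bar>W1 (Suc k) 0\<bar> / a)"
    using psi by (intro summable_add W_summable summable_divide) (simp_all add: V_coeff_initial del: One_nat_def)
  fix k
  let ?o = "\<omega> (Suc k)"
  have o: "?o = a * ?w k" by (simp add: wave_number_def)
  have w: "0 < ?w k" using wave_number_pos[OF pq] by simp
  have "\<bar>W (Suc k) 0 * cos (?o * t) + W1 (Suc k) 0 / ?o * sin (?o * t)\<bar>
      \<le> \<bar>W (Suc k) 0\<bar> * \<bar>cos (?o * t)\<bar> + \<bar>W1 (Suc k) 0 / ?o\<bar> * \<bar>sin (?o * t)\<bar>"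
    unfolding abs_mult[symmetric] by (rule abs_triangle_ineq)
  also have "\<dots> \<le> \<bar>W (Suc k) 0\<bar> * 1 + \<bar>W1 (Suc k) 0 / ?o\<bar> * 1"
    by (intro add_mono mult_left_mono) auto
  finally have "?w k * \<bar>W (Suc k) 0 * cos (?o * t) + W1 (Suc k) 0 / ?o * sin (?o * t)\<bar>
      \<le> ?w k * (\<bar>W (Suc k) 0\<bar> * 1 + \<bar>W1 (Suc k) 0 / ?o\<bar> * 1)"
    using w by (intro mult_left_mono) auto
  also have "\<dots> = ?w k * \<bar>W (Suc k) 0\<bar> + \<bar>W1 (Suc k) 0\<bar> / a"
    unfolding o using w a by (simp add: abs_mult field_simps)
  finally show "norm (?w k *
    \<bar>free_mode a p q (\<lambda>x. \<phi> x - e x * h 0) (\<lambda>x. \<psi> x - e x * deriv_on {0..} 1 h 0) (Suc k) t\<bar>)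
      \<le> ?w k * \<bar>W (Suc k) 0\<bar> + \<bar>W1 (Suc k) 0\<bar> / a"
    unfolding free_mode_def V_coeff_initial[symmetric] using w by (simp add: abs_mult)
qed

text \<open>The free part converges absolutely, by the decay of the coefficients of the initial data; the forced part
  is then a difference of two convergent series. Both the sine modes at a point and their
  derivatives are admissible multipliers \<open>m\<close>.\<close>
lemma split_series:
  assumes psi: "summable (\<lambda>k. \<bar>sine_coeff p q (Suc k) (\<lambda>x. \<psi> x - e x * deriv_on {0..} 1 h 0)\<bar>)"
    and t: "0 \<le> t" and m: "\<And>k. \<bar>m (Suc k)\<bar> \<le> C * wave_number p q (Suc k)"
    and S: "(\<lambda>k. V_coeff p q e h u k t * m k) sums\<^sub>1 S"
  shows "\<exists>A B. (\<lambda>k. free_mode a p q (\<lambda>x. \<phi> x - e x * h 0) (\<lambda>x. \<psi> x - e x * deriv_on {0..} 1 h 0) k t * m k) sums\<^sub>1 A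
    \<and> (\<lambda>k. forced_mode a p q e h k t * m k) sums\<^sub>1 B \<and> S = A + B"
proof -
  let ?f = "free_mode a p q (\<lambda>x. \<phi> x - e x * h 0) (\<lambda>x. \<psi> x - e x * deriv_on {0..} 1 h 0)"
  have "summable (\<lambda>k. ?f (Suc k) t * m (Suc k))"
  proof (rule summable_comparison_test')
    show "summable (\<lambda>k. C * (wave_number p q (Suc k) * \<bar>?f (Suc k) t\<bar>))"
      by (rule summable_mult[OF free_mode_summable[OF psi]])
    show "norm (?f (Suc k) t * m (Suc k)) \<le> C * (wave_number p q (Suc k) * \<bar>?f (Suc k) t\<bar>)" for k
      using mult_left_mono[OF m[of k], of "\<bar>?f (Suc k) t\<bar>"] by (simp add: abs_mult ac_simps)
  qed
  then obtain A where A: "(\<lambda>k. ?f (Suc k) t * m (Suc k)) sums A" by (auto simp: summable_def)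
  have "(\<lambda>k. V_coeff p q e h u (Suc k) t * m (Suc k) - ?f (Suc k) t * m (Suc k)) sums (S - A)"
    using S unfolding sums_from_1_def by (rule sums_diff[OF _ A])
  then have "(\<lambda>k. forced_mode a p q e h (Suc k) t * m (Suc k)) sums (S - A)"
    by (simp add: V_coeff_split[OF _ t] left_diff_distrib[symmetric] del: One_nat_def)
  with A show ?thesis unfolding sums_from_1_def by (intro exI[of _ A] exI[of _ "S - A"]) simp
qed

end

section \<open>The delay system for the travelling profiles\<close>

text \<open>If \<open>T W\<close> at time \<open>s\<close> is determined by \<open>W\<close> up to time \<open>s - \<delta>\<close>, then the iterates of \<open>T\<close> become stationary
  on \<open>{..n \<delta>}\<close> after \<open>n + 1\<close> steps. This is the method of steps; since the fixed point coincides locally with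
  an iterate, it inherits every local property of the iterates, such as continuity.\<close>
lemma causal_fixed_point:
  fixes T :: "(real \<Rightarrow> 'b) \<Rightarrow> real \<Rightarrow> 'b"
  assumes \<delta>: "0 < \<delta>"
    and base: "\<And>W W' s. s \<le> 0 \<Longrightarrow> T W s = T W' s"
    and causal: "\<And>W W' s. (\<And>r. r \<le> s - \<delta> \<Longrightarrow> W r = W' r) \<Longrightarrow> T W s = T W' s"
  shows "\<exists>W. T W = W \<and> (\<forall>N. \<exists>n. \<forall>s\<le>N. W s = (T ^^ n) W0 s)"
proof -
  define A where "A n = (T ^^ n) W0" for n
  have A_Suc: "A (Suc n) = T (A n)" for n by (simp add: A_def)
  have step: "A (Suc (Suc n)) s = A (Suc n) s" if "s \<le> real n * \<delta>" for n s
    using that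
  proof (induction n arbitrary: s)
    case 0
    then show ?case unfolding A_Suc[of "Suc 0"] A_Suc[of 0] by (intro base) simp
  next
    case (Suc n)
    then have "A (Suc (Suc n)) r = A (Suc n) r" if "r \<le> s - \<delta>" for r
      using that by (intro Suc.IH) (simp add: algebra_simps)
    then show ?case unfolding A_Suc[of "Suc (Suc n)"] A_Suc[of "Suc n"] by (rule causal)
  qed
  have stable: "A (Suc (n + k)) s = A (Suc n) s" if s: "s \<le> real n * \<delta>" for n k s
  proof (induction k)
    case (Suc k)
    have "real n * \<delta> \<le> real (n + k) * \<delta>" using \<delta> by (intro mult_right_mono) auto
    then show ?case using step[of s "n + k"] s Suc by simp
  qed simp
  define steps where "steps s = nat \<lceil>s / \<delta>\<rceil>" for s
  have steps_le: "s \<le> real (steps s) * \<delta>" for s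
  proof -
    have "s / \<delta> \<le> real (steps s)" unfolding steps_def by linarith
    then show ?thesis using \<delta> by (simp add: field_simps)
  qed
  define W where "W s = A (Suc (steps s)) s" for s
  have W_eq: "W s = A (Suc n) s" if "s \<le> real n * \<delta>" for n s
  proof -
    have "s / \<delta> \<le> real n" using that \<delta> by (simp add: field_simps)
    then have "steps s \<le> n" unfolding steps_def by linarith
    then show ?thesis using stable[OF steps_le, of s "n - steps s"] by (simp add: W_def)
  qed
  have "T W s = W s" for s
  proof -
    have "W r = A (Suc (steps s)) r" if "r \<le> s - \<delta>" for r
      by (rule W_eq) (use that steps_le[of s] \<delta> in linarith)
    then have "T W s = A (Suc (Suc (steps s))) s"
      unfolding A_Suc[of "Suc (steps s)"] by (rule causal)
    then show ?thesis using step[OF steps_le] by (simp add: W_def)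
  qed
  moreover have "\<forall>s\<le>N. W s = (T ^^ Suc (steps N)) W0 s" for N
    using W_eq[of _ "steps N"] steps_le[of N] by (auto simp: A_def[symmetric] simp del: funpow.simps)
  ultimately show ?thesis by blast
qed

lemma zero_derivative_imp_eq:
  fixes f :: "real \<Rightarrow> real"
  assumes "convex S" and "\<And>z. z \<in> S \<Longrightarrow> (f has_real_derivative 0) (at z within S)" and "x \<in> S" and "y \<in> S"
  shows "f x = f y"
  using has_field_derivative_zero_constant[OF assms(1,2)] assms(3,4) by metis

text \<open>The solution of \<open>k' + c k = r\<close> with \<open>k 0 = 0\<close>.\<close>
definition relax :: "real \<Rightarrow> (real \<Rightarrow> real) \<Rightarrow> real \<Rightarrow> real" where
  "relax c r s = exp (- c * s) * integral {0..s} (\<lambda>v. exp (c * v) * r v)"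

lemma relax_0 [simp]: "relax c r 0 = 0"
  by (simp add: relax_def)

lemma relax_cong: "(\<And>v. v \<le> s \<Longrightarrow> r v = r' v) \<Longrightarrow> relax c r s = relax c r' s"
  unfolding relax_def by (intro arg_cong[where f = "\<lambda>x. _ * x"] integral_cong) simp

lemma relax_has_derivative:
  assumes "continuous_on {0..} r" and "0 \<le> s"
  shows "(relax c r has_real_derivative r s - c * relax c r s) (at s within {0..})"
proof -
  have "((\<lambda>s. integral {0..s} (\<lambda>v. exp (c * v) * r v)) has_real_derivative exp (c * s) * r s)
      (at s within {0..s + 1})"
  proof (rule integral_has_real_derivative)
    show "continuous_on {0..s + 1} (\<lambda>v. exp (c * v) * r v)"
      by (intro continuous_intros continuous_on_subset[OF assms(1)]) auto
  qed (use assms(2) in simp)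
  moreover have "at s within {0..s + 1} = at s within {0..}"
    by (rule at_within_nhd[of s "{s - 1<..<s + 1}"]) auto
  ultimately have I: "((\<lambda>s. integral {0..s} (\<lambda>v. exp (c * v) * r v)) has_real_derivative exp (c * s) * r s)
      (at s within {0..})" by simp
  have E: "((\<lambda>s. exp (- c * s)) has_real_derivative - c * exp (- c * s)) (at s within {0..})"
    by (auto intro!: derivative_eq_intros)
  have "exp (- c * s) * (exp (c * s) * r s) = r s"
    by (simp add: exp_minus)
  then have "- c * exp (- c * s) * integral {0..s} (\<lambda>v. exp (c * v) * r v) + exp (c * s) * r s * exp (- c * s)
      = r s - c * relax c r s"
    unfolding relax_def by (simp only: ac_simps)
  then show ?thesis
    using DERIV_mult[OF E I] unfolding relax_def[abs_def] by (simp only:)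
qed

lemma relax_continuous: "continuous_on {0..} r \<Longrightarrow> continuous_on {0..} (relax c r)"
  by (rule DERIV_continuous_on[of _ _ "\<lambda>s. r s - c * relax c r s"]) (simp add: relax_has_derivative)

text \<open>Here \<open>f\<close> and \<open>g\<close> are the second derivatives of the two profiles, and \<open>k\<close> is the derivative of the common
  boundary value at the interface. The acceleration \<open>k'\<close> equals both increments \<open>f (s + l) - f (s - l)\<close>
  and \<open>g (s + m) - g (s - m)\<close>, and \<open>k' + c k = - f (s - l) - g (s - m)\<close>; so \<open>k'\<close> at time \<open>s\<close> depends on the
  profiles up to \<open>s - l\<close> and \<open>s - m\<close> only, while it determines them at \<open>s + l\<close> and \<open>s + m\<close>. The delay is thus
  \<open>2 min l m\<close>. Working with second derivatives, continuity is the only regularity to be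
  propagated; at the junctions \<open>s = l\<close> and \<open>s = m\<close> it holds because \<open>f0\<close> and \<open>g0\<close> take equal values at
  their end points and \<open>k' 0 = 0\<close>, which is the balance condition.\<close>
lemma delay_system_solvable:
  fixes l m c :: real and f0 g0 :: "real \<Rightarrow> real"
  assumes l: "0 < l" and m: "0 < m"
    and f0: "continuous_on {-l..l} f0" "f0 (- l) = f0 l"
    and g0: "continuous_on {-m..m} g0" "g0 (- m) = g0 m"
    and balance: "f0 l + g0 m = 0"
  shows "\<exists>f g k. continuous_on UNIV f \<and> continuous_on UNIV g \<and>
    (\<forall>s\<in>{-l..l}. f s = f0 s) \<and> (\<forall>s\<in>{-m..m}. g s = g0 s) \<and> k 0 = 0 \<and>
    (\<forall>s\<ge>0. (k has_real_derivative (f (s + l) - f (s - l))) (at s within {0..}) \<and>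
       g (s + m) - g (s - m) = f (s + l) - f (s - l) \<and>
       f (s + l) - f (s - l) + c * k s + f (s - l) + g (s - m) = 0)"
proof -
  \<comment> \<open>\<open>src\<close> is the forcing \<open>k' + c k\<close> and \<open>acc\<close> the acceleration \<open>k'\<close>; the arguments of \<open>f0\<close> and \<open>g0\<close> are clamped
    to the intervals on which these are known to be continuous\<close>
  define src where "src W v = - (fst (W (v - l)) + snd (W (v - m)))" for W :: "real \<Rightarrow> real \<times> real" and v
  define acc where "acc W v = src W v - c * relax c (src W) v" for W v
  define T where "T W s = (if s \<le> l then f0 (max (- l) s) else fst (W (s - 2 * l)) + acc W (s - l),
      if s \<le> m then g0 (max (- m) s) else snd (W (s - 2 * m)) + acc W (s - m))" for W s
  define W0 where "W0 s = (f0 (max (- l) (min l s)), g0 (max (- m) (min m s)))" for s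
  define K where "K W \<longleftrightarrow> continuous_on UNIV W \<and> fst (W (- l)) = f0 l \<and> snd (W (- m)) = g0 m" for W
  have src_cont: "continuous_on UNIV (src W)" if "continuous_on UNIV W" for W
    unfolding src_def
    by (intro continuous_intros continuous_on_compose2[OF that]) auto
  have acc_cont: "continuous_on {0..} (acc W)" if "continuous_on UNIV W" for W
    unfolding acc_def
    using continuous_on_subset[OF src_cont[OF that], of "{0..}"]
    by (intro continuous_intros relax_continuous) auto
  have acc_0: "acc W 0 = 0" if "K W" for W
    using that balance by (simp add: acc_def src_def K_def)
  have K_T: "K (T W)" if W: "K W" for W
  proof -
    have Wc: "continuous_on UNIV W" and Wl: "fst (W (- l)) = f0 l" and Wm: "snd (W (- m)) = g0 m"
      using W by (auto simp: K_def)
    have "continuous_on UNIV (\<lambda>s. if s \<le> l then f0 (max (- l) s) else fst (W (s - 2 * l)) + acc W (s - l))"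
    proof (rule continuous_on_cases_le)
      show "continuous_on {t \<in> UNIV. t \<le> l} (\<lambda>s. f0 (max (- l) s))"
        using l by (intro continuous_on_compose2[OF f0(1)] continuous_intros) auto
      show "continuous_on {t \<in> UNIV. l \<le> t} (\<lambda>s. fst (W (s - 2 * l)) + acc W (s - l))"
        by (intro continuous_intros continuous_on_compose2[OF Wc] continuous_on_compose2[OF acc_cont[OF Wc]]) auto
      show "f0 (max (- l) t) = fst (W (t - 2 * l)) + acc W (t - l)" if "t = l" for t
        using that l Wl acc_0[OF W] by simp
    qed (rule continuous_on_id)
    moreover have "continuous_on UNIV (\<lambda>s. if s \<le> m then g0 (max (- m) s) else snd (W (s - 2 * m)) + acc W (s - m))"
    proof (rule continuous_on_cases_le)
      show "continuous_on {t \<in> UNIV. t \<le> m} (\<lambda>s. g0 (max (- m) s))"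
        using m by (intro continuous_on_compose2[OF g0(1)] continuous_intros) auto
      show "continuous_on {t \<in> UNIV. m \<le> t} (\<lambda>s. snd (W (s - 2 * m)) + acc W (s - m))"
        by (intro continuous_intros continuous_on_compose2[OF Wc] continuous_on_compose2[OF acc_cont[OF Wc]]) auto
      show "g0 (max (- m) t) = snd (W (t - 2 * m)) + acc W (t - m)" if "t = m" for t
        using that m Wm acc_0[OF W] by simp
    qed (rule continuous_on_id)
    ultimately have "continuous_on UNIV (T W)" unfolding T_def by (intro continuous_on_Pair)
    then show ?thesis using l m f0(2) g0(2) by (simp add: K_def T_def)
  qed
  have "K W0"
  proof -
    have "continuous_on UNIV W0"
      unfolding W0_def using l m
      by (intro continuous_on_Pair continuous_on_compose2[OF f0(1)] continuous_on_compose2[OF g0(1)] continuous_intros) auto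
    then show ?thesis using l m f0(2) g0(2) by (simp add: K_def W0_def)
  qed
  then have K_iter: "K ((T ^^ n) W0)" for n by (induction n) (simp_all add: K_T)
  have "\<exists>W. T W = W \<and> (\<forall>N. \<exists>n. \<forall>s\<le>N. W s = (T ^^ n) W0 s)"
  proof (rule causal_fixed_point)
    show "0 < 2 * min l m" using l m by simp
    show "T W s = T W' s" if "s \<le> 0" for W W' s using that l m by (simp add: T_def)
    fix W W' :: "real \<Rightarrow> real \<times> real" and s
    assume eq: "W r = W' r" if "r \<le> s - 2 * min l m" for r
    have src_eq: "src W v = src W' v" if "v \<le> s - l \<or> v \<le> s - m" for v
      using eq[of "v - l"] eq[of "v - m"] that by (auto simp: src_def)
    have "acc W v = acc W' v" if "v = s - l \<or> v = s - m" for v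
    proof -
      have "relax c (src W) v = relax c (src W') v"
        by (rule relax_cong) (use src_eq that in auto)
      then show ?thesis using src_eq[of v] that by (auto simp: acc_def)
    qed
    then show "T W s = T W' s"
      using eq[of "s - 2 * l"] eq[of "s - 2 * m"] by (simp add: T_def)
  qed
  then obtain W where fixpt: "T W = W" and local: "\<And>N. \<exists>n. \<forall>s\<le>N. W s = (T ^^ n) W0 s" by blast
  have "isCont W x" for x
  proof -
    obtain n where n: "\<And>s. s \<le> x + 1 \<Longrightarrow> W s = (T ^^ n) W0 s" using local[of "x + 1"] by blast
    have "eventually (\<lambda>s. s < x + 1) (nhds x)" by (intro eventually_nhds_in_open[of "{..<x + 1}", simplified]) auto
    then have "eventually (\<lambda>s. W s = (T ^^ n) W0 s) (nhds x)"
      by eventually_elim (simp add: n)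
    moreover have "isCont ((T ^^ n) W0) x"
      using K_iter[of n] by (simp add: K_def continuous_on_eq_continuous_at)
    ultimately show ?thesis using isCont_cong by metis
  qed
  then have Wc: "continuous_on UNIV W" by (simp add: continuous_at_imp_continuous_on)
  have W_T: "W s = T W s" for s by (simp add: fixpt)
  have Wl: "fst (W s) = f0 s" if "s \<in> {-l..l}" for s
    using that by (subst W_T) (simp add: T_def max_def)
  have Wm: "snd (W s) = g0 s" if "s \<in> {-m..m}" for s
    using that by (subst W_T) (simp add: T_def max_def)
  have KW: "K W" using Wc Wl[of "- l"] Wm[of "- m"] l m f0(2) g0(2) by (simp add: K_def)
  have jump_l: "fst (W (s + l)) - fst (W (s - l)) = acc W s" if "0 \<le> s" for s
  proof (cases "s = 0")
    case True
    then show ?thesis using Wl[of l] Wl[of "- l"] l f0(2) acc_0[OF KW] by simp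
  next
    case False
    then show ?thesis using that by (subst W_T) (simp add: T_def)
  qed
  have jump_m: "snd (W (s + m)) - snd (W (s - m)) = acc W s" if "0 \<le> s" for s
  proof (cases "s = 0")
    case True
    then show ?thesis using Wm[of m] Wm[of "- m"] m g0(2) acc_0[OF KW] by simp
  next
    case False
    then show ?thesis using that by (subst W_T) (simp add: T_def)
  qed
  have "(relax c (src W) has_real_derivative acc W s) (at s within {0..})" if "0 \<le> s" for s
    unfolding acc_def
    by (rule relax_has_derivative[OF continuous_on_subset[OF src_cont[OF Wc]] that]) simp
  moreover have "acc W s + c * relax c (src W) s + fst (W (s - l)) + snd (W (s - m)) = 0" for s
    by (simp add: acc_def src_def)
  moreover have "continuous_on UNIV (\<lambda>s. fst (W s))" "continuous_on UNIV (\<lambda>s. snd (W s))"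
    by (intro continuous_intros Wc)+
  ultimately show ?thesis
    using Wl Wm jump_l jump_m
    by (intro exI[of _ "\<lambda>s. fst (W s)"] exI[of _ "\<lambda>s. snd (W s)"] exI[of _ "relax c (src W)"]) simp
qed

lemma antiderivative_on_line:
  fixes f :: "real \<Rightarrow> real"
  assumes "continuous_on UNIV f"
  obtains F where "\<And>x. (F has_real_derivative f x) (at x)" and "F 0 = c"
proof -
  have "\<exists>F. \<forall>x::real. -\<infinity> < ereal x \<longrightarrow> ereal x < \<infinity> \<longrightarrow> (F has_vector_derivative f x) (at x)"
    by (rule einterval_antiderivative) (use assms in \<open>auto simp: continuous_on_eq_continuous_at\<close>)
  then obtain F where F: "\<And>x. (F has_real_derivative f x) (at x)"
    by (auto simp: has_real_derivative_iff_has_vector_derivative)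
  have "((\<lambda>x. F x - F 0 + c) has_real_derivative f x) (at x)" for x
    by (auto intro!: derivative_eq_intros F)
  then show ?thesis by (rule that) simp
qed

text \<open>On \<open>[0, l]\<close> the data \<open>u = \<phi>\<close>, \<open>u\<^sub>t = \<psi>\<close> of \<open>u x t = F (a t + x) - F (a t - x)\<close> read \<open>F x - F (- x) = \<phi> x\<close> and
  \<open>a (F' x - F' (- x)) = \<psi> x\<close>. Differentiated to second order in \<open>F\<close>, they fix the odd and even parts of \<open>F''\<close>,
  and this is the resulting \<open>F''\<close> on \<open>[-l, l]\<close>.\<close>
definition initial_curvature :: "real \<Rightarrow> (real \<Rightarrow> real) \<Rightarrow> (real \<Rightarrow> real) \<Rightarrow> real \<Rightarrow> real" where
  "initial_curvature a \<phi>2 \<psi>1 s = (if s \<le> 0 then (\<psi>1 (- s) / a - \<phi>2 (- s)) / 2 else (\<psi>1 s / a + \<phi>2 s) / 2)"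

lemma initial_curvature_continuous:
  assumes "0 < a" and "continuous_on {0..l} \<phi>2" and "continuous_on {0..l} \<psi>1" and "\<phi>2 0 = 0"
  shows "continuous_on {-l..l} (initial_curvature a \<phi>2 \<psi>1)"
  unfolding initial_curvature_def
proof (rule continuous_on_cases_le)
  show "continuous_on {t \<in> {-l..l}. t \<le> 0} (\<lambda>s. (\<psi>1 (- s) / a - \<phi>2 (- s)) / 2)"
    using assms(1)
    by (intro continuous_intros continuous_on_compose2[OF assms(2)] continuous_on_compose2[OF assms(3)]) auto
  show "continuous_on {t \<in> {-l..l}. 0 \<le> t} (\<lambda>s. (\<psi>1 s / a + \<phi>2 s) / 2)"
    using assms(1)
    by (intro continuous_intros continuous_on_subset[OF assms(2)] continuous_on_subset[OF assms(3)]) auto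
qed (use assms(4) in \<open>auto intro!: continuous_intros\<close>)

text \<open>Initial data on a segment of length \<open>l\<close>, measured from the fixed end. The conditions at \<open>0\<close> make \<open>F''\<close>
  continuous at \<open>0\<close>; those at \<open>l\<close> make \<open>F''\<close> and \<open>F'\<close> agree at \<open>l\<close> and \<open>- l\<close>, so that the interface starts with zero velocity and
  acceleration.\<close>
locale wave_data =
  fixes a l :: real and \<phi> \<phi>1 \<phi>2 \<psi> \<psi>1 :: "real \<Rightarrow> real"
  assumes a: "0 < a" and l: "0 < l"
    and \<phi>1: "\<And>x. x \<in> {0..l} \<Longrightarrow> (\<phi> has_real_derivative \<phi>1 x) (at x within {0..l})"
    and \<phi>2: "\<And>x. x \<in> {0..l} \<Longrightarrow> (\<phi>1 has_real_derivative \<phi>2 x) (at x within {0..l})"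
    and \<phi>2_cont: "continuous_on {0..l} \<phi>2"
    and \<psi>1: "\<And>x. x \<in> {0..l} \<Longrightarrow> (\<psi> has_real_derivative \<psi>1 x) (at x within {0..l})"
    and \<psi>1_cont: "continuous_on {0..l} \<psi>1"
    and \<phi>_ends: "\<phi> 0 = 0" "\<phi> l = 0" and \<phi>2_ends: "\<phi>2 0 = 0" "\<phi>2 l = 0"
    and \<psi>_ends: "\<psi> 0 = 0" "\<psi> l = 0"
begin

abbreviation "f0 \<equiv> initial_curvature a \<phi>2 \<psi>1"

lemma f0_cont: "continuous_on {-l..l} f0"
  by (rule initial_curvature_continuous[OF a \<phi>2_cont \<psi>1_cont \<phi>2_ends(1)])

lemma f0_ends: "f0 l = \<psi>1 l / (2 * a)" "f0 (- l) = f0 l"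
  using l by (simp_all add: initial_curvature_def \<phi>2_ends)

lemma profile_initial_data:
  assumes F1: "\<And>s. (F has_real_derivative F1 s) (at s)"
    and F2: "\<And>s. (F1 has_real_derivative F2 s) (at s)"
    and F2_f0: "\<forall>s\<in>{-l..l}. F2 s = f0 s" and F1_0: "F1 0 = \<phi>1 0 / 2"
    and x: "x \<in> {0..l}"
  shows "F x - F (- x) = \<phi> x" and "F1 x + F1 (- x) = \<phi>1 x" and "a * (F1 x - F1 (- x)) = \<psi> x"
proof -
  note F1' = has_field_derivative_at_within[OF F1]
  note F2' = has_field_derivative_at_within[OF F2]
  have minus: "((\<lambda>z. - z) has_real_derivative - 1) (at z within S)" for z :: real and S
    by (auto intro!: derivative_eq_intros)
  have Fm: "((\<lambda>z. F (- z)) has_real_derivative - F1 (- z)) (at z within S)" for z S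
    using DERIV_chain2[OF F1 minus] by simp
  have F1m: "((\<lambda>z. F1 (- z)) has_real_derivative - F2 (- z)) (at z within S)" for z S
    using DERIV_chain2[OF F2 minus] by simp
  have odd: "F2 z - F2 (- z) = \<phi>2 z" and even: "a * (F2 z + F2 (- z)) = \<psi>1 z" if "z \<in> {0..l}" for z
  proof -
    have "z = 0 \<or> 0 < z" using that by auto
    then have "f0 z = (\<psi>1 z / a + \<phi>2 z) / 2" "f0 (- z) = (\<psi>1 z / a - \<phi>2 z) / 2"
      by (auto simp: initial_curvature_def \<phi>2_ends)
    moreover have "F2 z = f0 z" "F2 (- z) = f0 (- z)" using that F2_f0 by auto
    ultimately have F2_values: "F2 z = (\<psi>1 z / a + \<phi>2 z) / 2" "F2 (- z) = (\<psi>1 z / a - \<phi>2 z) / 2"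
      by simp_all
    have "(A + B) / 2 - (A - B) / 2 = B" and "(A + B) / 2 + (A - B) / 2 = A" for A B :: real
      by (simp_all add: field_simps)
    then show "F2 z - F2 (- z) = \<phi>2 z" and "a * (F2 z + F2 (- z)) = \<psi>1 z"
      unfolding F2_values using a by simp_all
  qed
  have zero: "0 \<in> {0..l}" using l by simp
  have slope: "F1 y + F1 (- y) = \<phi>1 y" if "y \<in> {0..l}" for y
  proof -
    have "((\<lambda>z. F1 z + F1 (- z) - \<phi>1 z) has_real_derivative 0) (at z within {0..l})" if "z \<in> {0..l}" for z
      using DERIV_diff[OF DERIV_add[OF F2' F1m] \<phi>2[OF that]] odd[OF that] by simp
    from zero_derivative_imp_eq[OF convex_real_interval(5) this that zero]
    show ?thesis using F1_0 by simp
  qed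
  then show "F1 x + F1 (- x) = \<phi>1 x" using x .
  have "((\<lambda>z. F z - F (- z) - \<phi> z) has_real_derivative 0) (at z within {0..l})" if "z \<in> {0..l}" for z
    using DERIV_diff[OF DERIV_diff[OF F1' Fm] \<phi>1[OF that]] slope[OF that] by simp
  from zero_derivative_imp_eq[OF convex_real_interval(5) this x zero]
  show "F x - F (- x) = \<phi> x" using \<phi>_ends by simp
  have "((\<lambda>z. a * (F1 z - F1 (- z)) - \<psi> z) has_real_derivative 0) (at z within {0..l})" if "z \<in> {0..l}" for z
    using DERIV_diff[OF DERIV_cmult[OF DERIV_diff[OF F2' F1m], of a] \<psi>1[OF that]] even[OF that] by simp
  from zero_derivative_imp_eq[OF convex_real_interval(5) this x zero]
  show "a * (F1 x - F1 (- x)) = \<psi> x" using \<psi>_ends by simp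
qed

end

text \<open>Integrating the delay system twice. In these units of time (\<open>s = a t\<close>) the jump condition is
  \<open>- 2 K' - 2 F' (s - l) - 2 G' (s - m) = \<sigma> K\<close> with \<open>K s = F (s + l) - F (s - l)\<close>, whence the damping constant \<open>\<sigma> / 2\<close>. Each
  integrated identity holds because its derivative vanishes for \<open>s \<ge> 0\<close> and the compatibility conditions make
  it true at \<open>s = 0\<close>.\<close>
theorem transmission_profiles_exist:
  assumes "wave_data a l \<phi> \<phi>1 \<phi>2 \<psi> \<psi>1" and "wave_data a m \<phi>' \<phi>1' \<phi>2' \<psi>' \<psi>1'"
    and slopes: "\<phi>1 l + \<phi>1' m = 0" and speeds: "\<psi>1 l + \<psi>1' m = 0"
  shows "\<exists>F F1 F2 G G1 G2.
    (\<forall>s. (F has_real_derivative F1 s) (at s)) \<and> (\<forall>s. (F1 has_real_derivative F2 s) (at s)) \<and>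
    continuous_on UNIV F2 \<and>
    (\<forall>s. (G has_real_derivative G1 s) (at s)) \<and> (\<forall>s. (G1 has_real_derivative G2 s) (at s)) \<and>
    continuous_on UNIV G2 \<and>
    (\<forall>x\<in>{0..l}. F x - F (- x) = \<phi> x \<and> a * (F1 x - F1 (- x)) = \<psi> x) \<and>
    (\<forall>x\<in>{0..m}. G x - G (- x) = \<phi>' x \<and> a * (G1 x - G1 (- x)) = \<psi>' x) \<and>
    (\<forall>s\<ge>0. G (s + m) - G (s - m) = F (s + l) - F (s - l) \<and>
       - (F1 (s + l) + F1 (s - l)) - (G1 (s + m) + G1 (s - m)) = \<sigma> * (F (s + l) - F (s - l)))"
proof -
  interpret A: wave_data a l \<phi> \<phi>1 \<phi>2 \<psi> \<psi>1 by fact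
  interpret B: wave_data a m \<phi>' \<phi>1' \<phi>2' \<psi>' \<psi>1' by fact
  have "A.f0 l + B.f0 m = 0"
    using speeds unfolding A.f0_ends B.f0_ends by (simp add: add_divide_distrib[symmetric])
  from delay_system_solvable[OF A.l B.l A.f0_cont A.f0_ends(2) B.f0_cont B.f0_ends(2) this, of "\<sigma> / 2"]
  obtain F2 G2 k where cont: "continuous_on UNIV F2" "continuous_on UNIV G2"
    and F2_f0: "\<forall>s\<in>{-l..l}. F2 s = A.f0 s" and G2_g0: "\<forall>s\<in>{-m..m}. G2 s = B.f0 s"
    and k0: "k 0 = 0"
    and k: "\<And>s. 0 \<le> s \<Longrightarrow> (k has_real_derivative (F2 (s + l) - F2 (s - l))) (at s within {0..})"
    and jump: "\<And>s. 0 \<le> s \<Longrightarrow> G2 (s + m) - G2 (s - m) = F2 (s + l) - F2 (s - l)"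
    and relaxation: "\<And>s. 0 \<le> s \<Longrightarrow> F2 (s + l) - F2 (s - l) + \<sigma> / 2 * k s + F2 (s - l) + G2 (s - m) = 0"
    by blast
  obtain F1 where F2: "\<And>x. (F1 has_real_derivative F2 x) (at x)" and F1_0: "F1 0 = \<phi>1 0 / 2"
    using antiderivative_on_line[OF cont(1)] by blast
  obtain G1 where G2: "\<And>x. (G1 has_real_derivative G2 x) (at x)" and G1_0: "G1 0 = \<phi>1' 0 / 2"
    using antiderivative_on_line[OF cont(2)] by blast
  obtain F where F1: "\<And>x. (F has_real_derivative F1 x) (at x)"
    using antiderivative_on_line[OF continuous_on_of_derivative[OF F2]] by blast
  obtain G where G1: "\<And>x. (G has_real_derivative G1 x) (at x)"
    using antiderivative_on_line[OF continuous_on_of_derivative[OF G2]] by blast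
  note initF = A.profile_initial_data[OF F1 F2 F2_f0 F1_0]
  note initG = B.profile_initial_data[OF G1 G2 G2_g0 G1_0]
  have shift: "((\<lambda>s. H (s + d)) has_real_derivative H' (s + d)) (at s within S)"
    if "\<And>x. (H has_real_derivative H' x) (at x)" for H H' :: "real \<Rightarrow> real" and d s S
  proof -
    have "((\<lambda>s. s + d) has_real_derivative 1) (at s within S)" by (auto intro!: derivative_eq_intros)
    from DERIV_chain2[OF that this] show ?thesis by simp
  qed
  note shiftm = shift[where d = "- d" for d, simplified]
  have conv: "convex {0::real..}" "(0::real) \<in> {0..}" by simp_all
  have lm: "l \<in> {0..l}" "m \<in> {0..m}" using A.l B.l by auto
  have F1_l: "F1 l - F1 (- l) = 0" using initF(3)[OF lm(1)] A.\<psi>_ends A.a by simp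
  have G1_m: "G1 m - G1 (- m) = 0" using initG(3)[OF lm(2)] B.\<psi>_ends B.a by simp
  have K1: "F1 (s + l) - F1 (s - l) = k s" if "0 \<le> s" for s
  proof -
    have "((\<lambda>s. F1 (s + l) - F1 (s - l) - k s) has_real_derivative 0) (at s within {0..})" if "s \<in> {0..}" for s
      using DERIV_diff[OF DERIV_diff[OF shift[OF F2, of l s] shiftm[OF F2, of l s]] k[of s]] that by simp
    from zero_derivative_imp_eq[OF conv(1) this _ conv(2), of s] show ?thesis using that F1_l k0 by simp
  qed
  have KG1: "G1 (s + m) - G1 (s - m) = k s" if "0 \<le> s" for s
  proof -
    have "((\<lambda>s. G1 (s + m) - G1 (s - m) - k s) has_real_derivative 0) (at s within {0..})" if "s \<in> {0..}" for s
      using DERIV_diff[OF DERIV_diff[OF shift[OF G2, of m s] shiftm[OF G2, of m s]] k[of s]] jump[of s] that by simp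
    from zero_derivative_imp_eq[OF conv(1) this _ conv(2), of s] show ?thesis using that G1_m k0 by simp
  qed
  have K: "G (s + m) - G (s - m) = F (s + l) - F (s - l)" if "0 \<le> s" for s
  proof -
    have "((\<lambda>s. G (s + m) - G (s - m) - (F (s + l) - F (s - l))) has_real_derivative 0) (at s within {0..})"
      if "s \<in> {0..}" for s
      using DERIV_diff[OF DERIV_diff[OF shift[OF G1, of m s] shiftm[OF G1, of m s]]
          DERIV_diff[OF shift[OF F1, of l s] shiftm[OF F1, of l s]]] K1[of s] KG1[of s] that by simp
    from zero_derivative_imp_eq[OF conv(1) this _ conv(2), of s] show ?thesis
      using that initF(1)[OF lm(1)] initG(1)[OF lm(2)] A.\<phi>_ends B.\<phi>_ends by simp
  qed
  have slope: "F1 (s + l) - F1 (s - l) + \<sigma> / 2 * (F (s + l) - F (s - l)) + F1 (s - l) + G1 (s - m) = 0"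
    if "0 \<le> s" for s
  proof -
    have "((\<lambda>s. F1 (s + l) - F1 (s - l) + \<sigma> / 2 * (F (s + l) - F (s - l)) + F1 (s - l) + G1 (s - m))
        has_real_derivative 0) (at s within {0..})" if "s \<in> {0..}" for s
      using DERIV_add[OF DERIV_add[OF DERIV_add[OF DERIV_diff[OF shift[OF F2, of l s] shiftm[OF F2, of l s]]
          DERIV_cmult[OF DERIV_diff[OF shift[OF F1, of l s] shiftm[OF F1, of l s]], of "\<sigma> / 2"]]
          shiftm[OF F2, of l s]] shiftm[OF G2, of m s]] K1[of s] relaxation[of s] that by simp
    from zero_derivative_imp_eq[OF conv(1) this _ conv(2), of s] show ?thesis
      using that initF(1,2)[OF lm(1)] initG(2)[OF lm(2)] A.\<phi>_ends F1_l G1_m slopes by simp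
  qed
  have balance: "- (F1 (s + l) + F1 (s - l)) - (G1 (s + m) + G1 (s - m)) = \<sigma> * (F (s + l) - F (s - l))"
    if "0 \<le> s" for s
    using slope[OF that] K1[OF that] KG1[OF that] by simp
  show ?thesis
    by (rule exI[of _ F], rule exI[of _ F1], rule exI[of _ F2], rule exI[of _ G], rule exI[of _ G1],
        rule exI[of _ G2], intro conjI allI ballI impI F1 F2 cont G1 G2 initF(1,3) initG(1,3) K balance)
qed

section \<open>The coupled problem\<close>

text \<open>The fixed end is \<open>x0\<close> and \<open>\<epsilon> (x - x0)\<close> is the distance from it, with \<open>\<epsilon> = 1\<close> on the left segment and
  \<open>\<epsilon> = - 1\<close> on the right one.\<close>
lemma dalembert_segment_wave:
  assumes pq: "p < q" and a: "0 < a" and \<epsilon>: "\<epsilon> * \<epsilon> = 1"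
    and F1: "\<And>s. (F has_real_derivative F1 s) (at s)"
    and F2: "\<And>s. (F1 has_real_derivative F2 s) (at s)"
    and F2_cont: "continuous_on UNIV F2"
    and h: "\<And>t. (h has_real_derivative h1 t) (at t)" "\<And>t. (h1 has_real_derivative h2 t) (at t)"
      "continuous_on UNIV h2"
    and e': "\<And>x. (e has_real_derivative e') (at x)"
    and ends: "\<And>t. 0 \<le> t \<Longrightarrow> v p t = e p * h t" "\<And>t. 0 \<le> t \<Longrightarrow> v q t = e q * h t"
    and u: "\<And>x t. x \<in> {p..q} \<Longrightarrow> 0 \<le> t \<Longrightarrow> u x t = v x t"
    and init: "\<And>x. x \<in> {p..q} \<Longrightarrow> v x 0 = \<phi> x"
      "\<And>x. x \<in> {p..q} \<Longrightarrow> a * (F1 (\<epsilon> * (x - x0)) - F1 (- (\<epsilon> * (x - x0)))) = \<psi> x"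
    and v: "\<And>x t. v x t = F (a * t + \<epsilon> * (x - x0)) - F (a * t - \<epsilon> * (x - x0))"
  shows "segment_wave a p q e' e h h1 h2 \<phi> \<psi> u v
    (\<lambda>x t. \<epsilon> * (F1 (a * t + \<epsilon> * (x - x0)) + F1 (a * t - \<epsilon> * (x - x0))))
    (\<lambda>x t. F2 (a * t + \<epsilon> * (x - x0)) - F2 (a * t - \<epsilon> * (x - x0)))
    (\<lambda>x t. a * (F1 (a * t + \<epsilon> * (x - x0)) - F1 (a * t - \<epsilon> * (x - x0))))
    (\<lambda>x t. a\<^sup>2 * (F2 (a * t + \<epsilon> * (x - x0)) - F2 (a * t - \<epsilon> * (x - x0))))"
proof
  show "p < q" "0 < a" by fact+
  have x_plus: "((\<lambda>x. H (a * t + \<epsilon> * (x - x0))) has_real_derivative H' (a * t + \<epsilon> * (x - x0)) * \<epsilon>) (at x)"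
    and x_minus: "((\<lambda>x. H (a * t - \<epsilon> * (x - x0))) has_real_derivative H' (a * t - \<epsilon> * (x - x0)) * - \<epsilon>) (at x)"
    and t_plus: "((\<lambda>t. H (a * t + \<epsilon> * (x - x0))) has_real_derivative H' (a * t + \<epsilon> * (x - x0)) * a) (at t)"
    and t_minus: "((\<lambda>t. H (a * t - \<epsilon> * (x - x0))) has_real_derivative H' (a * t - \<epsilon> * (x - x0)) * a) (at t)"
    if H: "\<And>s. (H has_real_derivative H' s) (at s)" for H H' x t
    by (rule DERIV_chain2[OF H]; auto intro!: derivative_eq_intros)+
  fix x t :: real
  show "((\<lambda>x. v x t) has_real_derivative \<epsilon> * (F1 (a * t + \<epsilon> * (x - x0)) + F1 (a * t - \<epsilon> * (x - x0)))) (at x)"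
    using DERIV_diff[OF x_plus[OF F1, of t x] x_minus[OF F1, of t x]] unfolding v by (simp add: algebra_simps)
  have "\<epsilon> * (A * \<epsilon> + B * - \<epsilon>) = A - B" for A B
  proof -
    have "\<epsilon> * (A * \<epsilon> + B * - \<epsilon>) = (\<epsilon> * \<epsilon>) * (A - B)" by (simp add: algebra_simps)
    then show ?thesis using \<epsilon> by simp
  qed
  then show "((\<lambda>x. \<epsilon> * (F1 (a * t + \<epsilon> * (x - x0)) + F1 (a * t - \<epsilon> * (x - x0)))) has_real_derivative
      F2 (a * t + \<epsilon> * (x - x0)) - F2 (a * t - \<epsilon> * (x - x0))) (at x)"
    using DERIV_cmult[OF DERIV_add[OF x_plus[OF F2, of t x] x_minus[OF F2, of t x]], of \<epsilon>] by (simp only:)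
  show "((\<lambda>t. v x t) has_real_derivative a * (F1 (a * t + \<epsilon> * (x - x0)) - F1 (a * t - \<epsilon> * (x - x0)))) (at t)"
    using DERIV_diff[OF t_plus[OF F1, of x t] t_minus[OF F1, of x t]] unfolding v by (simp add: algebra_simps)
  show "((\<lambda>t. a * (F1 (a * t + \<epsilon> * (x - x0)) - F1 (a * t - \<epsilon> * (x - x0)))) has_real_derivative
      a\<^sup>2 * (F2 (a * t + \<epsilon> * (x - x0)) - F2 (a * t - \<epsilon> * (x - x0)))) (at t)"
    using DERIV_cmult[OF DERIV_diff[OF t_plus[OF F2, of x t] t_minus[OF F2, of x t]], of a]
    by (simp add: algebra_simps power2_eq_square)
  show "a * (F1 (a * 0 + \<epsilon> * (x - x0)) - F1 (a * 0 - \<epsilon> * (x - x0))) = \<psi> x" if "x \<in> {p..q}"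
    using init(2)[OF that] by simp
next
  have F1_cont: "continuous_on UNIV F1" by (rule continuous_on_of_derivative[OF F2])
  show "continuous_on UNIV (\<lambda>(t, x). a * (F1 (a * t + \<epsilon> * (x - x0)) - F1 (a * t - \<epsilon> * (x - x0))))"
    unfolding case_prod_beta
    by (intro continuous_on_mult continuous_on_diff continuous_on_const
        continuous_on_compose2[OF F1_cont _ subset_UNIV] continuous_on_add continuous_on_fst continuous_on_snd
        continuous_on_id)
  show "continuous_on UNIV (\<lambda>(t, x). a\<^sup>2 * (F2 (a * t + \<epsilon> * (x - x0)) - F2 (a * t - \<epsilon> * (x - x0))))"
    unfolding case_prod_beta
    by (intro continuous_on_mult continuous_on_diff continuous_on_const
        continuous_on_compose2[OF F2_cont _ subset_UNIV] continuous_on_add continuous_on_fst continuous_on_snd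
        continuous_on_id)
qed (use h e' ends u init in auto)

lemma wave_data_left:
  assumes "0 < a" and "0 < l" and "l < L"
    and phi: "C_on 3 {0..L} \<phi>" and psi: "C_on 2 {0..L} \<psi>"
    and ends: "\<phi> 0 = 0" "\<phi> l = 0" "deriv_on {0..L} 2 \<phi> 0 = 0" "deriv_on {0..L} 2 \<phi> l = 0" "\<psi> 0 = 0" "\<psi> l = 0"
  shows "wave_data a l \<phi> (deriv_on {0..L} 1 \<phi>) (deriv_on {0..L} 2 \<phi>) \<psi> (deriv_on {0..L} 1 \<psi>)"
proof
  have sub: "{0..l} \<subseteq> {0..L}" using assms(3) by auto
  note D = C_on_has_derivative[THEN DERIV_subset, OF _ _ _ sub]
  fix x assume x: "x \<in> {0..l}"
  then have xL: "x \<in> {0..L}" using sub by auto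
  show "(\<phi> has_real_derivative deriv_on {0..L} 1 \<phi> x) (at x within {0..l})"
    using D[OF phi, of 0 x] xL by simp
  show "(deriv_on {0..L} 1 \<phi> has_real_derivative deriv_on {0..L} 2 \<phi> x) (at x within {0..l})"
    using D[OF phi, of 1 x] xL by (simp add: numeral_2_eq_2)
  show "(\<psi> has_real_derivative deriv_on {0..L} 1 \<psi> x) (at x within {0..l})"
    using D[OF psi, of 0 x] xL by simp
next
  have sub: "{0..l} \<subseteq> {0..L}" using assms(3) by auto
  show "continuous_on {0..l} (deriv_on {0..L} 2 \<phi>)" "continuous_on {0..l} (deriv_on {0..L} 1 \<psi>)"
    by (rule continuous_on_subset[OF C_on_continuous[OF phi] sub] continuous_on_subset[OF C_on_continuous[OF psi] sub]; simp)+
qed (use assms in auto)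

text \<open>On the right segment the distance from the fixed end is \<open>y = L - x\<close>, so the first derivatives change sign. For
  this reason slopes and velocity gradients of the two segments cancel at the interface.\<close>
lemma wave_data_right:
  assumes "0 < a" and "0 < l" and "l < L"
    and phi: "C_on 3 {0..L} \<phi>" and psi: "C_on 2 {0..L} \<psi>"
    and ends: "\<phi> l = 0" "\<phi> L = 0" "deriv_on {0..L} 2 \<phi> l = 0" "deriv_on {0..L} 2 \<phi> L = 0" "\<psi> l = 0" "\<psi> L = 0"
  shows "wave_data a (L - l) (\<lambda>y. \<phi> (L - y)) (\<lambda>y. - deriv_on {0..L} 1 \<phi> (L - y)) (\<lambda>y. deriv_on {0..L} 2 \<phi> (L - y))
    (\<lambda>y. \<psi> (L - y)) (\<lambda>y. - deriv_on {0..L} 1 \<psi> (L - y))"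
proof
  have img: "(\<lambda>y. L - y) ` {0..L - l} \<subseteq> {0..L}" using assms(2) by auto
  have reflect: "((\<lambda>y. f (L - y)) has_real_derivative - f' (L - y)) (at y within {0..L - l})"
    if "(f has_real_derivative f' (L - y)) (at (L - y) within {0..L})" for f f' :: "real \<Rightarrow> real" and y
  proof -
    have "((\<lambda>y. L - y) has_real_derivative - 1) (at y within {0..L - l})"
      by (auto intro!: derivative_eq_intros)
    from DERIV_image_chain[OF DERIV_subset[OF that img] this] show ?thesis by (simp add: o_def)
  qed
  fix y assume "y \<in> {0..L - l}"
  then have y: "L - y \<in> {0..L}" using img by auto
  show "((\<lambda>y. \<phi> (L - y)) has_real_derivative - deriv_on {0..L} 1 \<phi> (L - y)) (at y within {0..L - l})"
    using C_on_has_derivative[OF phi _ y, of 0] by (intro reflect) simp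
  have "(deriv_on {0..L} 1 \<phi> has_real_derivative deriv_on {0..L} 2 \<phi> (L - y)) (at (L - y) within {0..L})"
    using C_on_has_derivative[OF phi _ y, of 1] by (simp add: numeral_2_eq_2)
  from DERIV_minus[OF reflect[of _ "deriv_on {0..L} 2 \<phi>", OF this]]
  show "((\<lambda>y. - deriv_on {0..L} 1 \<phi> (L - y)) has_real_derivative deriv_on {0..L} 2 \<phi> (L - y)) (at y within {0..L - l})"
    by simp
  show "((\<lambda>y. \<psi> (L - y)) has_real_derivative - deriv_on {0..L} 1 \<psi> (L - y)) (at y within {0..L - l})"
    using C_on_has_derivative[OF psi _ y, of 0] by (intro reflect) simp
next
  have img: "(\<lambda>y. L - y) ` {0..L - l} \<subseteq> {0..L}" using assms(2) by auto
  show "continuous_on {0..L - l} (\<lambda>y. deriv_on {0..L} 2 \<phi> (L - y))"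
    by (rule continuous_on_compose2[OF C_on_continuous[OF phi] _ img]) (auto intro!: continuous_intros)
  show "continuous_on {0..L - l} (\<lambda>y. - deriv_on {0..L} 1 \<psi> (L - y))"
    by (intro continuous_on_minus, rule continuous_on_compose2[OF C_on_continuous[OF psi] _ img])
      (auto intro!: continuous_intros)
qed (use assms in auto)

text \<open>Absolute summability of the coefficients of the initial velocity; together with the factor \<open>1 / \<omega>\<^sub>k\<close> in \<open>Q\<^sub>k\<close> it
  allows the series with \<open>Q\<^sub>k\<close> to be differentiated once.\<close>
lemma sine_coeff_abs_summable:
  assumes pq: "p < q" and sub: "{p..q} \<subseteq> {x0..x1}" and psi: "C_on 2 {x0..x1} \<psi>" and ends: "\<psi> p = 0" "\<psi> q = 0"
  shows "summable (\<lambda>k. \<bar>sine_coeff p q (Suc k) \<psi>\<bar>)"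
proof (rule summable_comparison_test')
  let ?w = "\<lambda>k. wave_number p q (Suc k)"
  note D = C_on_has_derivative[THEN DERIV_subset, OF psi _ _ sub]
  have "summable (\<lambda>k. ?w k * \<bar>sine_coeff p q (Suc k) \<psi>\<bar>)"
  proof (rule sine_coeff_summable[OF pq _ _ _ ends])
    fix x assume x: "x \<in> {p..q}"
    then have "x \<in> {x0..x1}" using sub by auto
    then show "(\<psi> has_real_derivative deriv_on {x0..x1} 1 \<psi> x) (at x within {p..q})"
      "(deriv_on {x0..x1} 1 \<psi> has_real_derivative deriv_on {x0..x1} 2 \<psi> x) (at x within {p..q})"
      using D[of 0 x] D[of 1 x] by (simp_all add: numeral_2_eq_2)
  qed (rule continuous_on_subset[OF C_on_continuous[OF psi] sub], simp)
  then show "summable (\<lambda>k. (q - p) / pi * (?w k * \<bar>sine_coeff p q (Suc k) \<psi>\<bar>))"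
    by (rule summable_mult)
  fix k
  have "1 \<le> (q - p) / pi * ?w k" using pq by (simp add: wave_number_def)
  from mult_right_mono[OF this, of "\<bar>sine_coeff p q (Suc k) \<psi>\<bar>"]
  show "norm \<bar>sine_coeff p q (Suc k) \<psi>\<bar> \<le> (q - p) / pi * (?w k * \<bar>sine_coeff p q (Suc k) \<psi>\<bar>)"
    by simp
qed

lemma abs_sine_mode_le: "p < q \<Longrightarrow> \<bar>sine_mode p q (Suc k) x\<bar> \<le> (q - p) / pi * wave_number p q (Suc k)"
  using abs_modes_le_1(1)[of p q "Suc k" x] by (simp add: wave_number_def)

lemma abs_deriv_sine_mode_le: "p < q \<Longrightarrow> \<bar>deriv (sine_mode p q (Suc k)) x\<bar> \<le> 1 * wave_number p q (Suc k)"
  using mult_left_mono[OF abs_modes_le_1(2)[of p q "Suc k" x] wave_number_nonneg[of p q "Suc k"]]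
    wave_number_nonneg[of p q "Suc k"]
  by (simp add: deriv_sine_mode abs_mult)

lemma left_mode_formulas:
  assumes "0 < l" "0 < a"
  shows "free_mode a 0 l (\<lambda>x. \<phi> x - x / l * h 0) (\<lambda>x. \<psi> x - x / l * deriv_on {0..} 1 h 0) k t
    = P_coeff l \<phi> h k * cos (real k * pi * a / l * t) + Q_coeff l a \<psi> h k * sin (real k * pi * a / l * t)"
    and "forced_mode a 0 l (\<lambda>x. x / l) h k t = R_coeff l a h k t"
  using assms
  by (simp_all add: free_mode_def forced_mode_def P_coeff_def Q_coeff_def R_coeff_def sine_coeff_def sine_mode_def)

lemma right_mode_formulas:
  assumes "l < L" "0 < a"
  shows "free_mode a l L (\<lambda>x. \<phi> x - (L - x) / (L - l) * h 0) (\<lambda>x. \<psi> x - (L - x) / (L - l) * deriv_on {0..} 1 h 0) k t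
    = Pt_coeff l L \<phi> h k * cos (real k * pi * a / (L - l) * t) + Qt_coeff l L a \<psi> h k * sin (real k * pi * a / (L - l) * t)"
    and "forced_mode a l L (\<lambda>x. (L - x) / (L - l)) h k t = Rt_coeff l L a h k t"
proof -
  have "2 / (L - l) * I / (real k * pi * a / (L - l)) = 2 / (real k * pi * a) * I" for I
    using assms by simp
  then show "forced_mode a l L (\<lambda>x. (L - x) / (L - l)) h k t = Rt_coeff l L a h k t"
    unfolding forced_mode_def Rt_coeff_def sine_coeff_def sine_mode_def minus_divide_left by (simp only:)
qed (use assms in \<open>simp add: free_mode_def Pt_coeff_def Qt_coeff_def sine_coeff_def sine_mode_def\<close>)

theorem theorem2p4:
  fixes l L a \<sigma> :: real and \<phi> \<psi> :: "real \<Rightarrow> real"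
  assumes "0 < l" and "l < L" and "a > 0" and "\<sigma> > 0"
    and "C_on 3 {0..L} \<phi>" and "C_on 2 {0..L} \<psi>"
    and "\<phi> 0 = 0" and "\<phi> l = 0" and "\<phi> L = 0"
    and "deriv_on {0..L} 2 \<phi> 0 = 0" and "deriv_on {0..L} 2 \<phi> l = 0" and "deriv_on {0..L} 2 \<phi> L = 0"
    and "\<psi> 0 = 0" and "\<psi> l = 0" and "\<psi> L = 0"
  shows "\<exists>(h :: real \<Rightarrow> real) (u :: real \<Rightarrow> real \<Rightarrow> real).
    C_on 2 {0..} h \<and>
    formal_solution l L a \<sigma> \<phi> \<psi> h u \<and>
    (\<forall>t\<ge>0. \<forall>x. 0 < x \<and> x < l \<longrightarrow>
      (\<exists>A B.
        (\<lambda>k. (P_coeff l \<phi> h k * cos (real k * pi * a / l * t)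
             + Q_coeff l a \<psi> h k * sin (real k * pi * a / l * t)) * sin (real k * pi / l * x)) sums\<^sub>1 A \<and>
        (\<lambda>k. R_coeff l a h k t * sin (real k * pi / l * x)) sums\<^sub>1 B \<and>
        u x t = A + B + x / l * h t)) \<and>
    (\<forall>t\<ge>0. \<forall>x. l < x \<and> x < L \<longrightarrow>
      (\<exists>A B.
        (\<lambda>k. (Pt_coeff l L \<phi> h k * cos (real k * pi * a / (L - l) * t)
             + Qt_coeff l L a \<psi> h k * sin (real k * pi * a / (L - l) * t))
             * sin (real k * pi / (L - l) * (x - l))) sums\<^sub>1 A \<and>
        (\<lambda>k. Rt_coeff l L a h k t * sin (real k * pi / (L - l) * (x - l))) sums\<^sub>1 B \<and>
        u x t = A + B + (L - x) / (L - l) * h t)) \<and>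
    (\<forall>t\<ge>0. \<exists>A B C D.
        (\<lambda>k. (P_coeff l \<phi> h k * cos (real k * pi * a / l * t)
             + Q_coeff l a \<psi> h k * sin (real k * pi * a / l * t)) * (-1) ^ k * (real k * pi / l)) sums\<^sub>1 A \<and>
        (\<lambda>k. R_coeff l a h k t * (-1) ^ k * (real k * pi / l)) sums\<^sub>1 B \<and>
        (\<lambda>k. (Pt_coeff l L \<phi> h k * cos (real k * pi * a / (L - l) * t)
             + Qt_coeff l L a \<psi> h k * sin (real k * pi * a / (L - l) * t)) * (real k * pi / (L - l))) sums\<^sub>1 C \<and>
        (\<lambda>k. Rt_coeff l L a h k t * (real k * pi / (L - l))) sums\<^sub>1 D \<and>
        - A - B - 1 / l * h t + C + D - 1 / (L - l) * h t = \<sigma> * h t)"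
proof -
  note pos = assms(1-4)
  have data_left: "wave_data a l \<phi> (deriv_on {0..L} 1 \<phi>) (deriv_on {0..L} 2 \<phi>) \<psi> (deriv_on {0..L} 1 \<psi>)"
    by (rule wave_data_left) (use assms in auto)
  have data_right: "wave_data a (L - l) (\<lambda>y. \<phi> (L - y)) (\<lambda>y. - deriv_on {0..L} 1 \<phi> (L - y))
      (\<lambda>y. deriv_on {0..L} 2 \<phi> (L - y)) (\<lambda>y. \<psi> (L - y)) (\<lambda>y. - deriv_on {0..L} 1 \<psi> (L - y))"
    by (rule wave_data_right) (use assms in auto)
  have slopes: "deriv_on {0..L} 1 \<phi> l + - deriv_on {0..L} 1 \<phi> (L - (L - l)) = 0"
    and speeds: "deriv_on {0..L} 1 \<psi> l + - deriv_on {0..L} 1 \<psi> (L - (L - l)) = 0"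
    by simp_all
  obtain F F1 F2 G G1 G2 where
    F: "\<And>s. (F has_real_derivative F1 s) (at s)" "\<And>s. (F1 has_real_derivative F2 s) (at s)" "continuous_on UNIV F2"
    and G: "\<And>s. (G has_real_derivative G1 s) (at s)" "\<And>s. (G1 has_real_derivative G2 s) (at s)" "continuous_on UNIV G2"
    and F_init: "\<And>x. x \<in> {0..l} \<Longrightarrow> F x - F (- x) = \<phi> x"
      "\<And>x. x \<in> {0..l} \<Longrightarrow> a * (F1 x - F1 (- x)) = \<psi> x"
    and G_init: "\<And>y. y \<in> {0..L - l} \<Longrightarrow> G y - G (- y) = \<phi> (L - y)"
      "\<And>y. y \<in> {0..L - l} \<Longrightarrow> a * (G1 y - G1 (- y)) = \<psi> (L - y)"
    and match: "\<And>s. 0 \<le> s \<Longrightarrow> G (s + (L - l)) - G (s - (L - l)) = F (s + l) - F (s - l)"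
    and slope: "\<And>s. 0 \<le> s \<Longrightarrow> - (F1 (s + l) + F1 (s - l)) - (G1 (s + (L - l)) + G1 (s - (L - l)))
        = \<sigma> * (F (s + l) - F (s - l))"
    using transmission_profiles_exist[OF data_left data_right slopes speeds, of \<sigma>] by blast
  define h where "h t = F (a * t + l) - F (a * t - l)" for t
  define h1 where "h1 t = a * (F1 (a * t + l) - F1 (a * t - l))" for t
  define h2 where "h2 t = a\<^sup>2 * (F2 (a * t + l) - F2 (a * t - l))" for t
  have shift: "((\<lambda>t. H (a * t + d)) has_real_derivative a * H' (a * t + d)) (at t)"
    if "\<And>s. (H has_real_derivative H' s) (at s)" for H H' :: "real \<Rightarrow> real" and d t
  proof -
    have "((\<lambda>t. a * t + d) has_real_derivative a) (at t)" by (auto intro!: derivative_eq_intros)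
    from DERIV_chain2[OF that this] show ?thesis by (simp add: mult.commute)
  qed
  have h: "(h has_real_derivative h1 t) (at t)" "(h1 has_real_derivative h2 t) (at t)" for t
    using DERIV_diff[OF shift[OF F(1), of l t] shift[OF F(1), of "- l" t]]
      DERIV_cmult[OF DERIV_diff[OF shift[OF F(2), of l t] shift[OF F(2), of "- l" t]], of a]
    unfolding h_def[abs_def] h1_def[abs_def] h2_def
    by (simp_all add: right_diff_distrib power2_eq_square mult.assoc)
  have h2_cont: "continuous_on UNIV h2"
    unfolding h2_def by (intro continuous_intros continuous_on_compose2[OF F(3)]) auto
  define vl where "vl x t = F (a * t + 1 * (x - 0)) - F (a * t - 1 * (x - 0))" for x t
  define vr where "vr x t = G (a * t + - 1 * (x - L)) - G (a * t - - 1 * (x - L))" for x t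
  define u where "u x t = (if x \<le> l then vl x t else vr x t)" for x t
  have vl_l: "vl l t = h t" for t by (simp add: vl_def h_def)
  \<comment> \<open>the profiles are matched at the interface for nonnegative times, while the left identity defines \<open>h\<close>\<close>
  have vr_l: "vr l t = h t" if "0 \<le> t" for t
    using match[of "a * t"] that pos by (simp add: vr_def h_def)
  have u_ends: "u 0 t = 0" "u l t = h t" "u L t = 0" for t
    using pos vl_l by (simp_all add: u_def vl_def vr_def)
  obtain vlx vlxx vlt vltt where wave_left: "segment_wave a 0 l (1 / l) (\<lambda>x. x / l) h h1 h2 \<phi> \<psi> u vl vlx vlxx vlt vltt"
    and vlx: "\<And>t. vlx l t = F1 (a * t + l) + F1 (a * t - l)"
  proof -
    have "segment_wave a 0 l (1 / l) (\<lambda>x. x / l) h h1 h2 \<phi> \<psi> u vl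
      (\<lambda>x t. 1 * (F1 (a * t + 1 * (x - 0)) + F1 (a * t - 1 * (x - 0))))
      (\<lambda>x t. F2 (a * t + 1 * (x - 0)) - F2 (a * t - 1 * (x - 0)))
      (\<lambda>x t. a * (F1 (a * t + 1 * (x - 0)) - F1 (a * t - 1 * (x - 0))))
      (\<lambda>x t. a\<^sup>2 * (F2 (a * t + 1 * (x - 0)) - F2 (a * t - 1 * (x - 0))))"
    proof (rule dalembert_segment_wave[OF _ _ _ F h h2_cont])
      show "((\<lambda>x. x / l) has_real_derivative 1 / l) (at x)" for x
        using pos by (auto intro!: derivative_eq_intros)
    qed (use pos vl_l F_init in \<open>auto simp: u_def vl_def\<close>)
    then show thesis by (rule that) simp
  qed
  obtain vrx vrxx vrt vrtt where wave_right:
    "segment_wave a l L (- 1 / (L - l)) (\<lambda>x. (L - x) / (L - l)) h h1 h2 \<phi> \<psi> u vr vrx vrxx vrt vrtt"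
    and vrx: "\<And>t. vrx l t = - (G1 (a * t + (L - l)) + G1 (a * t - (L - l)))"
  proof -
    have "segment_wave a l L (- 1 / (L - l)) (\<lambda>x. (L - x) / (L - l)) h h1 h2 \<phi> \<psi> u vr
      (\<lambda>x t. - 1 * (G1 (a * t + - 1 * (x - L)) + G1 (a * t - - 1 * (x - L))))
      (\<lambda>x t. G2 (a * t + - 1 * (x - L)) - G2 (a * t - - 1 * (x - L)))
      (\<lambda>x t. a * (G1 (a * t + - 1 * (x - L)) - G1 (a * t - - 1 * (x - L))))
      (\<lambda>x t. a\<^sup>2 * (G2 (a * t + - 1 * (x - L)) - G2 (a * t - - 1 * (x - L))))"
    proof (rule dalembert_segment_wave[OF _ _ _ G h h2_cont])
      show "((\<lambda>x. (L - x) / (L - l)) has_real_derivative - 1 / (L - l)) (at x)" for x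
        by (rule DERIV_cdivide) (auto intro!: derivative_eq_intros)
      show "u x t = vr x t" if "x \<in> {l..L}" "0 \<le> t" for x t
        using that vl_l vr_l by (auto simp: u_def)
      show "vr x 0 = \<phi> x" if "x \<in> {l..L}" for x
        using G_init(1)[of "L - x"] that by (simp add: vr_def)
      show "a * (G1 (- 1 * (x - L)) - G1 (- (- 1 * (x - L)))) = \<psi> x" if "x \<in> {l..L}" for x
        using G_init(2)[of "L - x"] that by simp
    qed (use pos vr_l in \<open>auto simp: vr_def\<close>)
    then show thesis by (rule that) simp
  qed
  interpret left: segment_wave a 0 l "1 / l" "\<lambda>x. x / l" h h1 h2 \<phi> \<psi> u vl vlx vlxx vlt vltt
    by (rule wave_left)
  interpret right: segment_wave a l L "- 1 / (L - l)" "\<lambda>x. (L - x) / (L - l)" h h1 h2 \<phi> \<psi> u vr vrx vrxx vrt vrtt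
    by (rule wave_right)
  \<comment> \<open>the interface starts at rest, so the velocity data in \<open>Q\<^sub>k\<close> are just \<open>\<psi>\<close>\<close>
  have h1_0: "deriv_on {0..} 1 h 0 = 0"
    using F_init(2)[of l] pos assms left.deriv_on_h(2)[of 0] by (simp add: h1_def)
  have psi_left: "summable (\<lambda>k. \<bar>sine_coeff 0 l (Suc k) (\<lambda>x. \<psi> x - x / l * deriv_on {0..} 1 h 0)\<bar>)"
    unfolding h1_0 using sine_coeff_abs_summable[of 0 l 0 L \<psi>] assms by simp
  have psi_right: "summable (\<lambda>k. \<bar>sine_coeff l L (Suc k) (\<lambda>x. \<psi> x - (L - x) / (L - l) * deriv_on {0..} 1 h 0)\<bar>)"
    unfolding h1_0 using sine_coeff_abs_summable[of l L 0 L \<psi>] assms by simp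
  note split_left = left.split_series[OF psi_left, unfolded left_mode_formulas[OF pos(1,3)]]
  note split_right = right.split_series[OF psi_right, unfolded right_mode_formulas[OF pos(2,3)]]
  have jump: "- vlx l t + vrx l t = \<sigma> * u l t" if "0 \<le> t" for t
    using slope[of "a * t"] that pos by (simp add: vlx vrx u_ends h_def)
  have sol: "formal_solution l L a \<sigma> \<phi> \<psi> h u"
    unfolding formal_solution_def Let_def
  proof (intro conjI allI impI ballI)
    fix t :: real assume t: "0 \<le> t"
    show "\<exists>m r. series_slope 0 l (\<lambda>x. x / l) h u t l m \<and> series_slope l L (\<lambda>x. (L - x) / (L - l)) h u t l r \<and>
        - m + r = \<sigma> * u l t"
      using left.series_slope[OF t, of l] right.series_slope[OF t, of l] jump[OF t] pos
      by (intro exI[of _ "vlx l t"] exI[of _ "vrx l t"]) simp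
  qed (rule u_ends left.series_value right.series_value left.formal_wave_ivp right.formal_wave_ivp;
      use pos in simp)+
  have interior_left: "\<exists>A B.
        (\<lambda>k. (P_coeff l \<phi> h k * cos (real k * pi * a / l * t)
             + Q_coeff l a \<psi> h k * sin (real k * pi * a / l * t)) * sin (real k * pi / l * x)) sums\<^sub>1 A \<and>
        (\<lambda>k. R_coeff l a h k t * sin (real k * pi / l * x)) sums\<^sub>1 B \<and>
        u x t = A + B + x / l * h t" if t: "0 \<le> t" and x: "0 < x" "x < l" for t x
  proof -
    have "x \<in> {0..l}" using x by simp
    from split_left[OF t abs_sine_mode_le[OF pos(1)] left.sine_series(1)[OF t this]]
    show ?thesis by (simp only: sine_mode_def diff_0_right diff_eq_eq)
  qed
  have interior_right: "\<exists>A B.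
        (\<lambda>k. (Pt_coeff l L \<phi> h k * cos (real k * pi * a / (L - l) * t)
             + Qt_coeff l L a \<psi> h k * sin (real k * pi * a / (L - l) * t))
             * sin (real k * pi / (L - l) * (x - l))) sums\<^sub>1 A \<and>
        (\<lambda>k. Rt_coeff l L a h k t * sin (real k * pi / (L - l) * (x - l))) sums\<^sub>1 B \<and>
        u x t = A + B + (L - x) / (L - l) * h t" if t: "0 \<le> t" and x: "l < x" "x < L" for t x
  proof -
    have "x \<in> {l..L}" using x by simp
    from split_right[OF t abs_sine_mode_le[OF pos(2)] right.sine_series(1)[OF t this]]
    show ?thesis by (simp only: sine_mode_def diff_eq_eq)
  qed
  have interface: "\<exists>A B C D.
        (\<lambda>k. (P_coeff l \<phi> h k * cos (real k * pi * a / l * t)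
             + Q_coeff l a \<psi> h k * sin (real k * pi * a / l * t)) * (-1) ^ k * (real k * pi / l)) sums\<^sub>1 A \<and>
        (\<lambda>k. R_coeff l a h k t * (-1) ^ k * (real k * pi / l)) sums\<^sub>1 B \<and>
        (\<lambda>k. (Pt_coeff l L \<phi> h k * cos (real k * pi * a / (L - l) * t)
             + Qt_coeff l L a \<psi> h k * sin (real k * pi * a / (L - l) * t)) * (real k * pi / (L - l))) sums\<^sub>1 C \<and>
        (\<lambda>k. Rt_coeff l L a h k t * (real k * pi / (L - l))) sums\<^sub>1 D \<and>
        - A - B - 1 / l * h t + C + D - 1 / (L - l) * h t = \<sigma> * h t" if t: "0 \<le> t" for t
  proof -
    have slope_left: "deriv (sine_mode 0 l k) l = (-1) ^ k * (real k * pi / l)" for k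
      using pos by (simp add: deriv_sine_mode cosine_mode_ends wave_number_def)
    have slope_right: "deriv (sine_mode l L k) l = real k * pi / (L - l)" for k
      using pos by (simp add: deriv_sine_mode cosine_mode_ends wave_number_def)
    have l: "l \<in> {0..l}" "l \<in> {l..L}" using pos by auto
    from split_left[OF t abs_deriv_sine_mode_le[OF pos(1)] left.sine_series(2)[OF t l(1)]]
    obtain A B where AB:
      "(\<lambda>k. (P_coeff l \<phi> h k * cos (real k * pi * a / l * t)
             + Q_coeff l a \<psi> h k * sin (real k * pi * a / l * t)) * (-1) ^ k * (real k * pi / l)) sums\<^sub>1 A"
      "(\<lambda>k. R_coeff l a h k t * (-1) ^ k * (real k * pi / l)) sums\<^sub>1 B" "vlx l t - 1 / l * h t = A + B"
      unfolding slope_left mult.assoc[symmetric] by blast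
    from split_right[OF t abs_deriv_sine_mode_le[OF pos(2)] right.sine_series(2)[OF t l(2)]]
    obtain C D where CD:
      "(\<lambda>k. (Pt_coeff l L \<phi> h k * cos (real k * pi * a / (L - l) * t)
             + Qt_coeff l L a \<psi> h k * sin (real k * pi * a / (L - l) * t)) * (real k * pi / (L - l))) sums\<^sub>1 C"
      "(\<lambda>k. Rt_coeff l L a h k t * (real k * pi / (L - l))) sums\<^sub>1 D" "vrx l t - - 1 / (L - l) * h t = C + D"
      unfolding slope_right by blast
    have "- A - B - 1 / l * h t + C + D - 1 / (L - l) * h t = \<sigma> * h t"
      using AB(3) CD(3) jump[OF t] by (simp add: u_ends)
    with AB(1,2) CD(1,2) show ?thesis by blast
  qed
  show ?thesis
    using left.deriv_on_h(1) sol interior_left interior_right interface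
    by (intro exI[of _ h] exI[of _ u]) blast
qed

end
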